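(* Let $\Omega\subseteq[0,1]^d$ be a closed Peano–Jordan measurable set with positive measure, let $a_i\in C^1(\Omega)$ and let $b_i,c$ be continuous functions on $\Omega$ ($i=1,\dots,d$), all real-valued. Let $\mathbf n+\mathbf 1=n\boldsymbol\nu$ with $\boldsymbol\nu=(\nu_1,\dots,\nu_d)$ a fixed vector of (positive) rational constants, and let $A_{\mathbf n}^{\Omega^\circ}$ be the matrix of the Shortley–Weller finite difference discretization of $$-\sum_{i=1}^d\frac{\partial}{\partial x_i}\Big(a_i\frac{\partial u}{\partial x_i}\Big)+\sum_{i=1}^db_i\frac{\partial u}{\partial x_i}+cu=f\ \text{ in }\Omega^\circ,\qquad u=0\ \text{ on }\partial\Omega,$$ as defined explicitly in the context. Then $\{n^{-2}A_{\mathbf n}^{\Omega^\circ}\}_n$ is a reduced GLT sequence with respect to $\Omega^\circ$, with reduced GLT symbol $$\{n^{-2}A_{\mathbf n}^{\Omega^\circ}\}_n\sim_{GLT}^{\Omega^\circ}\kappa(x,\theta)=\sum_{i=1}^d\nu_i^2a_i(x)(2-2\cos\theta_i),\qquad (x,\theta)\in\Omega^\circ\times[-\pi,\pi]^d.$$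
   Context: Multi-index conventions. $\mathbf n=(n_1,\dots,n_d)\in\mathbb N^d$ depends on $n$, with $\mathbf n+\mathbf 1=n\boldsymbol\nu$ ($n$ ranging over the positive integers for which $n\boldsymbol\nu$ is an integer vector); $N(\mathbf n)=\prod_jn_j$; operations on multi-indices are componentwise; $\mathbf 1=(1,\dots,1)$; $\mathbf e_i$ are the canonical basis vectors. Matrices of size $N(\mathbf n)$ are indexed by $\mathbf 1\le\mathbf i\le\mathbf n$ in lexicographic order. $\mu$ is Lebesgue measure; a set is Peano–Jordan measurable iff its boundary has measure zero. $\Omega^\circ$ is the interior of $\Omega$ in $\mathbb R^d$. Shortley–Weller matrix. Let $h_i=1/(n_i+1)$ and $x_{\mathbf j}=(j_1h_1,\dots,j_dh_d)$ for real vectors $\mathbf j$ (so $x_{\mathbf j}+sh_i\mathbf e_i=x_{\mathbf j+s\mathbf e_i}$). $\Xi_n=\{x_{\mathbf j}:\mathbf 0\le\mathbf j\le\mathbf n+\mathbf 1,\ \mathbf j\in\mathbb Z^d\}$ and $\Xi_n'=\Xi_n\cap\Omega^\circ$. For $x_{\mathbf j}\in\Xi_n'$ set $s_i^\pm=s_i^\pm(\mathbf j)=\sup\{t\in[0,1]: x_{\mathbf j}\pm rh_i\mathbf e_i\in\Omega^\circ\ \forall\,0\le r\le t\}\in(0,1]$. The rows and columns of $A_{\mathbf n}^{\Omega^\circ}$ are indexed by those $\mathbf j$ with $x_{\mathbf j}\in\Xi'_n$, in lexicographic order, and $$(A_{\mathbf n}^{\Omega^\circ})_{\mathbf j,\mathbf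 i}=\begin{cases}\displaystyle\sum_{i=1}^d\Big[\frac{a_i(x_{\mathbf j+s_i^+\mathbf e_i/2})}{\frac12s_i^+(s_i^++s_i^-)h_i^2}+\frac{a_i(x_{\mathbf j-s_i^-\mathbf e_i/2})}{\frac12s_i^-(s_i^++s_i^-)h_i^2}\Big]+c(x_{\mathbf j}),&\mathbf i=\mathbf j,\\[2mm] \displaystyle\frac{-a_i(x_{\mathbf j\pm\mathbf e_i/2})}{\frac12(s_i^++s_i^-)h_i^2}\pm\frac{b_i(x_{\mathbf j})}{(s_i^++s_i^-)h_i},&\mathbf i=\mathbf j\pm\mathbf e_i,\ s_i^\pm=1,\\ 0,&\text{otherwise.}\end{cases}$$ a.c.s. convergence. For matrices of size $d_n$, $\{B_{n,m}\}_n\xrightarrow{\text{a.c.s.}}\{A_n\}_n$ as $m\to\infty$ means: for every $m$ there is $n_m$ such that for $n>n_m$ one can write $A_n=B_{n,m}+N_{n,m}+R_{n,m}$ with spectral norm $\|N_{n,m}\|\le\omega(m)$ and $\mathrm{rank}(R_{n,m})\le c(m)d_n$, where $\omega(m),c(m)\to0$. GLT sequences. For $f\in L^1([-\pi,\pi]^d)$, $T_{\mathbf n}(f)=[f_{\mathbf i-\mathbf j}]_{\mathbf i,\mathbf j=\mathbf 1}^{\mathbf n}$ with $f_{\mathbf k}=(2\pi)^{-d}\int_{[-\pi,\pi]^d}f(\theta)e^{-\mathrm i\,\mathbf k\cdot\theta}d\theta$; for $a:[0,1]^d\to\mathbb C$, $D_{\mathbf n}(a)=\mathrm{diag}(a(\mathbf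 i/\mathbf n))_{\mathbf i=\mathbf 1}^{\mathbf n}$. A sequence $\{A_{\mathbf n}\}_n$ with $A_{\mathbf n}$ of size $N(\mathbf n)$ is a ($d$-level) GLT sequence with symbol the measurable function $k:[0,1]^d\times[-\pi,\pi]^d\to\mathbb C$, written $\{A_{\mathbf n}\}_n\sim_{GLT}k$, iff there are finitely many (for each $m$) $a_{i,m}\in C^\infty([0,1]^d)$ and trigonometric polynomials $f_{i,m}$ in $d$ variables such that $\sum_ia_{i,m}(x)f_{i,m}(\theta)\to k$ in measure and $\{\sum_iD_{\mathbf n}(a_{i,m})T_{\mathbf n}(f_{i,m})\}_n\xrightarrow{\text{a.c.s.}}\{A_{\mathbf n}\}_n$ as $m\to\infty$ (a standard characterization of GLT sequences). Reduced GLT. For a Peano–Jordan measurable $U\subseteq[0,1]^d$ with $\mu(U)>0$, let $d_n^U$ be the number of $\mathbf 1\le\mathbf i\le\mathbf n$ with $\mathbf i/(\mathbf n+\mathbf 1)\in U$. $R_U$ sends a matrix of size $N(\mathbf n)$ to its $d_n^U\times d_n^U$ principal submatrix on those indices (kept in lexicographic order), applied to sequences termwise. $\{S_{\mathbf n}\}_n\sim_{GLT}^Us$ means that $\{S_{\mathbf n}\}_n=R_U(\{A_{\mathbf n}\}_n)$ for some GLT sequence $\{A_{\mathbf n}\}_n\sim_{GLT}k$ with $s=k|_{U\times[-\pi,\pi]^d}$ a.e. *)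

theory Defs
  imports
    "HOL-Analysis.Analysis"
    "HOL-Library.Fun_Lexorder"
    "Jordan_Normal_Form.DL_Submatrix"
    "Jordan_Normal_Form.DL_Rank"
begin

(* Both Finite_Cartesian_Product and Jordan_Normal_Form.Matrix use "$" (and the type name vec).
   Below, "$" and the notation real^'d always refer to Finite_Cartesian_Product, whereas matrices
   and the vectors they act on are those of Jordan_Normal_Form. *)
no_notation Matrix.vec_index (infixl "$" 100)

section \<open>Multi-indices\<close>

text \<open>
  The dimension \<open>d\<close> is the cardinality of the index type \<open>'d\<close>, whose linear order is needed only to
  speak about the lexicographic order. Multi-indices are integer vectors, since differences
  of multi-indices occur; the order and the intervals on \<open>int^'d\<close> are componentwise.
\<close>

definition rvec :: "int^'d \<Rightarrow> real^'d::finite" where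
  "rvec j = (\<chi> k. real_of_int (j $ k))"

definition admissible :: "real^'d::finite \<Rightarrow> nat set" where
  "admissible \<nu> = {n. n > 0 \<and> (\<forall>k. real n * \<nu> $ k \<in> \<int>)}"

text \<open>For admissible \<open>n\<close> the multi-index \<open>mindex \<nu> n\<close> is the one with \<open>mindex \<nu> n + 1 = n \<nu>\<close>.\<close>

definition mindex :: "real^'d::finite \<Rightarrow> nat \<Rightarrow> int^'d" where
  "mindex \<nu> n = (\<chi> k. \<lfloor>real n * \<nu> $ k\<rfloor> - 1)"

definition msize :: "int^'d::finite \<Rightarrow> nat" where
  "msize n = nat (\<Prod>k\<in>UNIV. n $ k)"

definition lex_less :: "int^'d::{finite,linorder} \<Rightarrow> int^'d::{finite,linorder} \<Rightarrow> bool" where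
  "lex_less i j \<longleftrightarrow> less_fun (($) i) (($) j)"

text \<open>The elements of a finite set of multi-indices, listed in increasing lexicographic order.\<close>

definition lex_list :: "(int^'d::{finite,linorder}) set \<Rightarrow> (int^'d::{finite,linorder}) list" where
  "lex_list S = (THE xs. sorted_wrt lex_less xs \<and> set xs = S)"

lemma lex_less_irrefl: "\<not> lex_less i i"
  by (simp add: lex_less_def less_fun_irrefl)

lemma lex_less_trans: "lex_less i j \<Longrightarrow> lex_less j k \<Longrightarrow> lex_less i k"
  unfolding lex_less_def by (rule less_fun_trans)

lemma lex_less_linear: "lex_less i j \<or> i = j \<or> lex_less j i"
  for i j :: "int^'d::{finite,linorder}"
proof (cases "i = j")
  case False
  let ?K = "{k. i $ k \<noteq> j $ k}"
  have ne: "?K \<noteq> {}" using False by (auto simp: Finite_Cartesian_Product.vec_eq_iff)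
  define m where "m = Min ?K"
  have m: "i $ m \<noteq> j $ m" using Min_in[of ?K] ne unfolding m_def by auto
  have eq: "i $ k = j $ k" if "k < m" for k
  proof (rule ccontr)
    assume "i $ k \<noteq> j $ k"
    then have "m \<le> k" unfolding m_def by (intro Min_le) auto
    with that show False by simp
  qed
  show ?thesis
  proof (cases "i $ m < j $ m")
    case True
    then show ?thesis unfolding lex_less_def less_fun_def using eq by blast
  next
    case False
    then have "j $ m < i $ m" using m by simp
    then show ?thesis unfolding lex_less_def less_fun_def using eq by fastforce
  qed
qed simp

lemma lex_list_exists:
  "finite S \<Longrightarrow> \<exists>xs. sorted_wrt lex_less xs \<and> set xs = S"
  for S :: "(int^'d::{finite,linorder}) set"
proof (induction S rule: finite_induct)
  case empty
  then show ?case by (intro exI[of _ "[]"]) simp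
next
  case (insert a S)
  then obtain xs where xs: "sorted_wrt lex_less xs" "set xs = S" by blast
  let ?ys = "filter (\<lambda>x. lex_less x a) xs @ a # filter (\<lambda>x. lex_less a x) xs"
  have "sorted_wrt lex_less ?ys"
    using xs(1) by (auto simp: sorted_wrt_append sorted_wrt_filter intro: lex_less_trans)
  moreover have "set ?ys = insert a S"
    using lex_less_linear[of _ a] insert.hyps xs(2) by auto
  ultimately show ?case by blast
qed

lemma lex_list_unique:
  "sorted_wrt lex_less xs \<Longrightarrow> sorted_wrt lex_less ys \<Longrightarrow> set xs = set ys \<Longrightarrow> xs = ys"
proof (induction xs arbitrary: ys)
  case (Cons x xs)
  then obtain y ys' where ys: "ys = y # ys'" by (cases ys) auto
  have xy: "x = y"
    using Cons.prems lex_less_trans lex_less_irrefl unfolding ys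
    by (metis list.set_intros(1) set_ConsD sorted_wrt.simps(2))
  have "x \<notin> set xs" "y \<notin> set ys'"
    using Cons.prems lex_less_irrefl unfolding ys by auto
  then have "set xs = set ys'" using Cons.prems(3) xy unfolding ys by auto
  then have "xs = ys'" using Cons unfolding ys by auto
  then show ?case using xy ys by simp
qed simp

lemma lex_list:
  assumes "finite S"
  shows "sorted_wrt lex_less (lex_list S)" and "set (lex_list S) = S"
proof -
  have "\<exists>!xs. sorted_wrt lex_less xs \<and> set xs = S"
    using lex_list_exists[OF assms] lex_list_unique by blast
  from theI'[OF this]
  show "sorted_wrt lex_less (lex_list S)" and "set (lex_list S) = S"
    unfolding lex_list_def by auto
qed


section \<open>The Shortley--Weller matrix\<close>

definition step :: "int^'d::finite \<Rightarrow> 'd \<Rightarrow> real" where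
  "step n k = 1 / (of_int (n $ k) + 1)"

definition grid_pt :: "int^'d::finite \<Rightarrow> real^'d \<Rightarrow> real^'d" where
  "grid_pt n y = (\<chi> k. y $ k * step n k)"

definition sw_index :: "(real^'d::finite) set \<Rightarrow> int^'d \<Rightarrow> (int^'d) set" where
  "sw_index W n = {j. 0 \<le> j \<and> j \<le> n + 1 \<and> grid_pt n (rvec j) \<in> W}"

text \<open>\<open>sw_s W n j k \<sigma>\<close> is \<open>s\<^sub>k\<^sup>+(j)\<close> for \<open>\<sigma> = 1\<close> and \<open>s\<^sub>k\<^sup>-(j)\<close> for \<open>\<sigma> = -1\<close>.\<close>

definition sw_s :: "(real^'d::finite) set \<Rightarrow> int^'d \<Rightarrow> int^'d \<Rightarrow> 'd \<Rightarrow> int \<Rightarrow> real" where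
  "sw_s W n j k \<sigma> =
     Sup {t \<in> {0..1}. \<forall>r\<in>{0..t}.
            grid_pt n (rvec j) + (of_int \<sigma> * r * step n k) *\<^sub>R axis k 1 \<in> W}"

text \<open>
  In the off-diagonal case at most one pair \<open>(k, \<sigma>)\<close> satisfies \<open>i = j + \<sigma> e\<^sub>k\<close>, so that the
  double sum has at most one nonzero term.
\<close>

definition sw_entry ::
  "('d \<Rightarrow> real^'d \<Rightarrow> real) \<Rightarrow> ('d \<Rightarrow> real^'d \<Rightarrow> real) \<Rightarrow> (real^'d \<Rightarrow> real) \<Rightarrow>
   (real^'d::finite) set \<Rightarrow> int^'d \<Rightarrow> int^'d \<Rightarrow> int^'d \<Rightarrow> real" where
  "sw_entry a b c W n j i =
    (if i = j then
       (\<Sum>k\<in>UNIV.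
          a k (grid_pt n (rvec j + (sw_s W n j k 1 / 2) *\<^sub>R axis k 1)) /
            (1/2 * sw_s W n j k 1 * (sw_s W n j k 1 + sw_s W n j k (-1)) * (step n k)\<^sup>2) +
          a k (grid_pt n (rvec j - (sw_s W n j k (-1) / 2) *\<^sub>R axis k 1)) /
            (1/2 * sw_s W n j k (-1) * (sw_s W n j k 1 + sw_s W n j k (-1)) * (step n k)\<^sup>2))
       + c (grid_pt n (rvec j))
     else
       (\<Sum>k\<in>UNIV. \<Sum>\<sigma>\<in>{1, -1}.
          if i = j + axis k \<sigma> \<and> sw_s W n j k \<sigma> = 1 then
            - a k (grid_pt n (rvec j + (of_int \<sigma> / 2) *\<^sub>R axis k 1)) /
              (1/2 * (sw_s W n j k 1 + sw_s W n j k (-1)) * (step n k)\<^sup>2)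
            + of_int \<sigma> * (b k (grid_pt n (rvec j)) /
              ((sw_s W n j k 1 + sw_s W n j k (-1)) * step n k))
          else 0))"

definition sw_matrix ::
  "('d \<Rightarrow> real^'d::{finite,linorder} \<Rightarrow> real) \<Rightarrow> ('d \<Rightarrow> real^'d::{finite,linorder} \<Rightarrow> real) \<Rightarrow> (real^'d::{finite,linorder} \<Rightarrow> real) \<Rightarrow>
   (real^'d::{finite,linorder}) set \<Rightarrow> int^'d::{finite,linorder} \<Rightarrow> complex mat" where
  "sw_matrix a b c W n =
     (let js = lex_list (sw_index W n) in
      Matrix.mat (length js) (length js)
        (\<lambda>(p, q). complex_of_real (sw_entry a b c W n (js ! p) (js ! q))))"


section \<open>Regularity of functions and sets\<close>

text \<open>
  Continuously differentiable functions on a closed set \<open>S\<close>: the function is continuous on \<open>S\<close>,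
  differentiable in the interior, and the partial derivatives up to order \<open>k\<close> extend continuously
  to \<open>S\<close>. Restrictions to \<open>S\<close> of functions that are \<open>C\<^sup>k\<close> on a neighbourhood of \<open>S\<close> are included.
\<close>

primrec Ck_on :: "nat \<Rightarrow> (real^'d::finite) set \<Rightarrow> (real^'d \<Rightarrow> 'b::real_normed_vector) \<Rightarrow> bool" where
  "Ck_on 0 S f \<longleftrightarrow> continuous_on S f"
| "Ck_on (Suc k) S f \<longleftrightarrow> continuous_on S f \<and>
     (\<exists>D. (\<forall>x\<in>interior S. (f has_derivative (\<lambda>v. \<Sum>l\<in>UNIV. v $ l *\<^sub>R D l x)) (at x)) \<and>
          (\<forall>l. Ck_on k S (D l)))"

definition Cinf_on :: "(real^'d::finite) set \<Rightarrow> (real^'d \<Rightarrow> 'b::real_normed_vector) \<Rightarrow> bool" where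
  "Cinf_on S f \<longleftrightarrow> (\<forall>k. Ck_on k S f)"

definition peano_jordan :: "(real^'d::finite) set \<Rightarrow> bool" where
  "peano_jordan U \<longleftrightarrow> frontier U \<in> null_sets lebesgue"

abbreviation unit_cube :: "(real^'d::finite) set" where
  "unit_cube \<equiv> cbox 0 1"

abbreviation freq_cube :: "(real^'d::finite) set" where
  "freq_cube \<equiv> cbox (\<chi> k. -pi) (\<chi> k. pi)"


section \<open>Approximating classes of sequences\<close>

definition l2_norm :: "complex Matrix.vec \<Rightarrow> real" where
  "l2_norm v = L2_set (\<lambda>p. cmod (vec_index v p)) {..<dim_vec v}"

definition spectral_norm :: "complex mat \<Rightarrow> real" where
  "spectral_norm A = Sup {l2_norm (A *\<^sub>v v) | v. v \<in> carrier_vec (dim_col A) \<and> l2_norm v \<le> 1}"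

text \<open>Sequences are indexed by the elements \<open>n\<close> of \<open>I\<close>; \<open>A n\<close> and \<open>B n m\<close> have size \<open>dn n\<close>.\<close>

definition acs_converges ::
  "nat set \<Rightarrow> (nat \<Rightarrow> nat) \<Rightarrow> (nat \<Rightarrow> nat \<Rightarrow> complex mat) \<Rightarrow> (nat \<Rightarrow> complex mat) \<Rightarrow> bool" where
  "acs_converges I dn B A \<longleftrightarrow>
     (\<exists>\<omega> c. \<omega> \<longlonglongrightarrow> (0::real) \<and> c \<longlonglongrightarrow> (0::real) \<and>
       (\<forall>m. \<exists>n0. \<forall>n\<in>I. n > n0 \<longrightarrow>
         (\<exists>N\<in>carrier_mat (dn n) (dn n). \<exists>R\<in>carrier_mat (dn n) (dn n).
            A n = B n m + N + R \<and>
            spectral_norm N \<le> \<omega> m \<and>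
            real (vec_space.rank (dn n) R) \<le> c m * real (dn n))))"


section \<open>Generalized locally Toeplitz sequences\<close>

definition fourier_coeff :: "(real^'d::finite \<Rightarrow> complex) \<Rightarrow> int^'d \<Rightarrow> complex" where
  "fourier_coeff f k =
     (LINT \<theta>:freq_cube|lborel. f \<theta> * exp (- (\<i> * complex_of_real (rvec k \<bullet> \<theta>)))) /
     complex_of_real ((2 * pi) ^ CARD('d))"

definition toeplitz_mat ::
  "(real^'d::{finite,linorder} \<Rightarrow> complex) \<Rightarrow> int^'d::{finite,linorder} \<Rightarrow> complex mat" where
  "toeplitz_mat f n =
     (let js = lex_list {1..n} in
      Matrix.mat (msize n) (msize n) (\<lambda>(p, q). fourier_coeff f (js ! p - js ! q)))"

definition diag_sampling_mat ::
  "(real^'d::{finite,linorder} \<Rightarrow> complex) \<Rightarrow> int^'d::{finite,linorder} \<Rightarrow> complex mat" where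
  "diag_sampling_mat a n =
     (let js = lex_list {1..n} in
      Matrix.mat (msize n) (msize n)
        (\<lambda>(p, q). if p = q then a (\<chi> k. of_int (js ! p $ k) / of_int (n $ k)) else 0))"

definition trig_poly :: "(real^'d::finite \<Rightarrow> complex) \<Rightarrow> bool" where
  "trig_poly f \<longleftrightarrow>
     (\<exists>K (c :: int^'d \<Rightarrow> complex). finite K \<and>
        f = (\<lambda>\<theta>. \<Sum>k\<in>K. c k * exp (\<i> * complex_of_real (rvec k \<bullet> \<theta>))))"

definition tendsto_in_measure ::
  "'a measure \<Rightarrow> (nat \<Rightarrow> 'a \<Rightarrow> complex) \<Rightarrow> ('a \<Rightarrow> complex) \<Rightarrow> bool" where
  "tendsto_in_measure M g h \<longleftrightarrow>
     (\<forall>\<epsilon>>0. (\<lambda>m. emeasure M {p \<in> space M. cmod (g m p - h p) > \<epsilon>}) \<longlonglongrightarrow> 0)"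

definition mat_sum :: "nat \<Rightarrow> (nat \<Rightarrow> complex mat) \<Rightarrow> nat \<Rightarrow> complex mat" where
  "mat_sum N F r = foldr (\<lambda>l M. F l + M) [0..<r] (0\<^sub>m N N)"

text \<open>
  \<open>glt \<nu> A \<kappa>\<close>: \<open>{A n}\<close> is a GLT sequence with symbol \<open>\<kappa>\<close>, where the multi-index of \<open>A n\<close>
  is \<open>mindex \<nu> n\<close>. Only the terms with admissible \<open>n\<close> belong to the sequence.
\<close>

definition glt ::
  "real^'d::{finite,linorder} \<Rightarrow> (nat \<Rightarrow> complex mat) \<Rightarrow>
   ((real^'d::{finite,linorder}) \<times> (real^'d::{finite,linorder}) \<Rightarrow> complex) \<Rightarrow> bool" where
  "glt \<nu> A \<kappa> \<longleftrightarrow>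
     (\<forall>n\<in>admissible \<nu>. A n \<in> carrier_mat (msize (mindex \<nu> n)) (msize (mindex \<nu> n))) \<and>
     \<kappa> \<in> borel_measurable (lebesgue_on (unit_cube \<times> freq_cube)) \<and>
     (\<exists>(r :: nat \<Rightarrow> nat) a f.
        (\<forall>m. \<forall>l<r m. Cinf_on unit_cube (a m l) \<and> trig_poly (f m l)) \<and>
        tendsto_in_measure (lebesgue_on (unit_cube \<times> freq_cube))
          (\<lambda>m (x, \<theta>). \<Sum>l<r m. a m l x * f m l \<theta>) \<kappa> \<and>
        acs_converges (admissible \<nu>) (\<lambda>n. msize (mindex \<nu> n))
          (\<lambda>n m. mat_sum (msize (mindex \<nu> n))
             (\<lambda>l. diag_sampling_mat (a m l) (mindex \<nu> n) * toeplitz_mat (f m l) (mindex \<nu> n)) (r m))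
          A)"


section \<open>Reduced GLT sequences\<close>

text \<open>The positions, in the lexicographic list of \<open>{1..n}\<close>, of the \<open>i\<close> with \<open>i / (n + 1) \<in> U\<close>.\<close>

definition restr_positions :: "(real^'d::{finite,linorder}) set \<Rightarrow> int^'d::{finite,linorder} \<Rightarrow> nat set" where
  "restr_positions U n = {p. p < msize n \<and> grid_pt n (rvec (lex_list {1..n} ! p)) \<in> U}"

definition restr_mat ::
  "(real^'d::{finite,linorder}) set \<Rightarrow> int^'d::{finite,linorder} \<Rightarrow> complex mat \<Rightarrow> complex mat" where
  "restr_mat U n A = submatrix A (restr_positions U n) (restr_positions U n)"

definition reduced_glt ::
  "real^'d::{finite,linorder} \<Rightarrow> (real^'d::{finite,linorder}) set \<Rightarrow> (nat \<Rightarrow> complex mat) \<Rightarrow>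
   ((real^'d::{finite,linorder}) \<times> (real^'d::{finite,linorder}) \<Rightarrow> complex) \<Rightarrow> bool" where
  "reduced_glt \<nu> U S s \<longleftrightarrow>
     U \<subseteq> unit_cube \<and> peano_jordan U \<and> emeasure lebesgue U > 0 \<and>
     (\<exists>A \<kappa>. glt \<nu> A \<kappa> \<and>
        (\<forall>n\<in>admissible \<nu>. S n = restr_mat U (mindex \<nu> n) (A n)) \<and>
        (AE p in lebesgue_on (U \<times> freq_cube). s p = \<kappa> p))"

end

theory Submission
  imports Defs
begin

text \<open>
  Extend the scaled matrix by zero rows and columns to all indices \<open>1 \<le> j \<le> n\<close>; its symbol should
  then be the given one on the interior \<open>W\<close> of \<open>\<Omega>\<close> and zero outside. In a row whose grid point has
  distance at least \<open>\<delta>\<close> from the complement of \<open>W\<close>, all step fractions are 1 for fine grids, and the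
  entries are, up to \<open>O(1/n)\<close> and the modulus of continuity of the \<open>a\<^sub>k\<close>, those of the sum of
  \<open>D(p\<^sub>k) T(\<nu>\<^sub>k\<^sup>2 (2 - 2 cos \<theta>\<^sub>k))\<close>, where \<open>p\<^sub>k\<close> is a polynomial uniformly close to a continuous extension
  of \<open>a\<^sub>k\<close> times a cut-off function that vanishes off \<open>W\<close>. The same holds for rows outside \<open>W\<close>, where
  both sides are small. Only the rows within \<open>\<delta>\<close> of the boundary are bad; they form a term of
  small rank, since the number of grid points near the null set \<open>\<partial>\<Omega>\<close> is controlled by the volume of a
  neighbourhood of it. On the other rows the difference has small entries on a fixed stencil, hence
  small norm by Schur's test.
\<close>

no_notation scalar_prod (infix "\<bullet>" 70)


section \<open>Lists of multi-indices\<close>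

text \<open>Reading a vector as its coordinate function turns a componentwise interval into a
  product of integer intervals, which yields finiteness and cardinality of index sets.\<close>

lemma bij_betw_multi_index:
  fixes m n :: "int^'d::finite"
  shows "bij_betw ($) {m..n} (Pi\<^sub>E UNIV (\<lambda>k. {m $ k..n $ k}))"
proof (rule bij_betwI[where g = vec_lambda])
  show "($) \<in> {m..n} \<rightarrow> (\<Pi>\<^sub>E k\<in>UNIV. {m $ k..n $ k})"
    by (auto simp: Finite_Cartesian_Product.less_eq_vec_def)
  show "vec_lambda \<in> (\<Pi>\<^sub>E k\<in>UNIV. {m $ k..n $ k}) \<rightarrow> {m..n}"
    by (auto simp: Finite_Cartesian_Product.less_eq_vec_def PiE_def Pi_def)
qed auto

lemma finite_multi_index: "finite {m..n}" for m n :: "int^'d::finite"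
  using bij_betw_finite[OF bij_betw_multi_index[of m n]] by (auto intro!: finite_PiE)

text \<open>The sign condition is essential: two negative components would give \<open>msize\<close>
  a positive value although \<open>{1..n}\<close> is empty.\<close>

lemma card_multi_index:
  fixes n :: "int^'d::finite"
  assumes "\<And>k. 0 \<le> n $ k"
  shows "card {1..n} = msize n"
proof -
  have "card {1..n} = (\<Prod>k\<in>UNIV. nat (n $ k))"
    using bij_betw_same_card[OF bij_betw_multi_index[of 1 n]] by (simp add: card_PiE)
  also have "\<dots> = msize n"
    unfolding msize_def using assms 
    by (intro int_int_eq[THEN iffD1]) (simp add: prod_nonneg)
  finally show ?thesis .
qed

lemma distinct_lex_list:
  assumes "finite S"
  shows "distinct (lex_list S)"
proof -
  have "distinct xs" if "sorted_wrt lex_less xs" for xs :: "(int^'d::{finite,linorder}) list"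
    using that by (induction xs) (auto simp: lex_less_irrefl)
  then show ?thesis using lex_list(1)[OF assms] .
qed

lemma length_lex_list: "finite S \<Longrightarrow> length (lex_list S) = card S"
  using distinct_card[OF distinct_lex_list, of S] by (simp add: lex_list(2))

lemma bij_betw_lex_list:
  assumes "finite S"
  shows "bij_betw ((!) (lex_list S)) {..<card S} S"
  using bij_betw_nth[OF distinct_lex_list[OF assms] _ lex_list(2)[OF assms, symmetric]]
  by (simp add: length_lex_list assms)

lemma sorted_wrt_nths: "sorted_wrt P xs \<Longrightarrow> sorted_wrt P (nths xs I)"
  by (induction xs arbitrary: I)
     (auto simp: nths_Cons dest: subsetD[OF set_nths_subset])

text \<open>Selecting positions preserves lexicographic order, and a sorted list is determined by
  its set. This matches the row order of a principal submatrix with that of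
  \<open>sw_matrix\<close>.\<close>

lemma nths_lex_list:
  assumes "finite S" "S' = {lex_list S ! p | p. p < card S \<and> p \<in> I}"
  shows "nths (lex_list S) I = lex_list S'"
proof (rule lex_list_unique)
  have "finite S'" using assms by simp
  then show "sorted_wrt lex_less (lex_list S')" "set (nths (lex_list S) I) = set (lex_list S')"
    using assms by (auto simp: lex_list set_nths length_lex_list)
  show "sorted_wrt lex_less (nths (lex_list S) I)"
    by (intro sorted_wrt_nths lex_list assms)
qed


section \<open>Rank and spectral norm\<close>

text \<open>Peel off one row at a time: a matrix supported on a single row is an outer product, so
  it has rank at most 1, and rank is subadditive.\<close>

lemma rank_le_card_nonzero_rows:
  fixes R :: "'a::field mat"
  assumes "finite B" "R \<in> carrier_mat N N"
    and "\<And>p q. p < N \<Longrightarrow> q < N \<Longrightarrow> p \<notin> B \<Longrightarrow> R $$ (p, q) = 0"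
  shows "vec_space.rank N R \<le> card B"
  using assms
proof (induction B arbitrary: R rule: finite_induct)
  case empty
  then have "R = 0\<^sub>m N N" by (intro eq_matI) auto
  then show ?case using vec_space.rank_0I[of N N] by (simp del: vec_space.rank_0I)
next
  case (insert b B)
  define R1 where "R1 = Matrix.mat N N (\<lambda>(p, q). if p = b then 0 else R $$ (p, q))"
  define R2 where "R2 = Matrix.mat N N (\<lambda>(p, q). if p = b then R $$ (b, q) else 0)"
  have c: "R1 \<in> carrier_mat N N" "R2 \<in> carrier_mat N N" by (simp_all add: R1_def R2_def)
  have "R = R1 + R2"
    using insert.prems(1) by (intro eq_matI) (auto simp: R1_def R2_def)
  then have "vec_space.rank N R \<le> vec_space.rank N R1 + vec_space.rank N R2"
    using vec_space.rank_subadditive[OF c] by simp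
  moreover have "vec_space.rank N R1 \<le> card B"
    by (rule insert.IH[OF c(1)]) (use insert.prems in \<open>auto simp: R1_def\<close>)
  moreover have "vec_space.rank N R2 \<le> 1"
    by (rule vec_space.rank_le_1_product_entries[OF c(2), where f = "\<lambda>p. if p = b then 1 else 0" and g = "\<lambda>q. R $$ (b, q)"])
      (auto simp: R2_def)
  ultimately show ?case using insert.hyps by simp
qed

lemma L2_set_power2: "(L2_set f A)\<^sup>2 = (\<Sum>i\<in>A. (f i)\<^sup>2)"
  by (simp add: L2_set_def sum_nonneg)

text \<open>Cauchy-Schwarz with weights given by the moduli of the entries: the row sums bound one
  factor, and after exchanging the summations the column sums bound the other.\<close>

lemma schur_test:
  assumes "A \<in> carrier_mat N N" "0 \<le> s"
    and row: "\<And>p. p < N \<Longrightarrow> (\<Sum>q<N. cmod (A $$ (p, q))) \<le> s"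
    and col: "\<And>q. q < N \<Longrightarrow> (\<Sum>p<N. cmod (A $$ (p, q))) \<le> s"
  shows "spectral_norm A \<le> s"
  unfolding spectral_norm_def
proof (rule cSup_least)
  \<comment> \<open>A real supremum is bounded by an upper bound only when the set is nonempty; the
    zero vector provides an element.\<close>
  have "l2_norm (0\<^sub>v (dim_col A)) \<le> 1" by (simp add: l2_norm_def L2_set_def)
  then show "{l2_norm (A *\<^sub>v v) |v. v \<in> carrier_vec (dim_col A) \<and> l2_norm v \<le> 1} \<noteq> {}"
    using zero_carrier_vec by blast
next
  fix x assume "x \<in> {l2_norm (A *\<^sub>v v) |v. v \<in> carrier_vec (dim_col A) \<and> l2_norm v \<le> 1}"
  then obtain v where v: "v \<in> carrier_vec N" "l2_norm v \<le> 1" and x: "x = l2_norm (A *\<^sub>v v)"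
    using assms(1) by auto
  define y where "y = (\<lambda>q. cmod (vec_index v q))"
  define a where "a = (\<lambda>p q. cmod (A $$ (p, q)))"
  have a0: "0 \<le> a p q" for p q by (simp add: a_def)
  have y1: "(\<Sum>q<N. (y q)\<^sup>2) \<le> 1"
    using v by (simp add: l2_norm_def L2_set_def y_def real_sqrt_le_1_iff)
  have entry: "cmod (vec_index (A *\<^sub>v v) p) ^ 2 \<le> s * (\<Sum>q<N. a p q * (y q)\<^sup>2)" if p: "p < N" for p
  proof -
    have "vec_index (A *\<^sub>v v) p = (\<Sum>q<N. A $$ (p, q) * vec_index v q)"
      using p v assms(1) by (auto simp: scalar_prod_def lessThan_atLeast0 intro!: sum.cong)
    \<comment> \<open>Each weight is split into two square roots, so that Cauchy-Schwarz leaves the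
      plain row sum in one factor and the weighted squares of \<open>y\<close> in the other.\<close>
    then have "cmod (vec_index (A *\<^sub>v v) p) \<le> (\<Sum>q<N. sqrt (a p q) * (sqrt (a p q) * y q))"
      using norm_sum[of "\<lambda>q. A $$ (p, q) * vec_index v q" "{..<N}"]
      by (simp add: norm_mult a_def y_def mult.assoc[symmetric])
    then have "cmod (vec_index (A *\<^sub>v v) p) ^ 2 \<le> (\<Sum>q<N. sqrt (a p q) * (sqrt (a p q) * y q))\<^sup>2"
      by (intro power_mono) auto
    also have "\<dots> \<le> (\<Sum>q<N. (sqrt (a p q))\<^sup>2) * (\<Sum>q<N. (sqrt (a p q) * y q)\<^sup>2)"
      by (rule Cauchy_Schwarz_ineq_sum)
    also have "\<dots> = (\<Sum>q<N. a p q) * (\<Sum>q<N. a p q * (y q)\<^sup>2)"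
      by (simp add: power_mult_distrib a0)
    also have "\<dots> \<le> s * (\<Sum>q<N. a p q * (y q)\<^sup>2)"
      using row[OF p] by (intro mult_right_mono sum_nonneg mult_nonneg_nonneg a0) (auto simp: a_def)
    finally show ?thesis .
  qed
  have "x\<^sup>2 = (\<Sum>p<N. (cmod (vec_index (A *\<^sub>v v) p))\<^sup>2)"
    using assms(1) by (simp add: x l2_norm_def L2_set_power2)
  also have "\<dots> \<le> (\<Sum>p<N. s * (\<Sum>q<N. a p q * (y q)\<^sup>2))"
    by (intro sum_mono entry) auto
  also have "\<dots> = s * (\<Sum>q<N. (\<Sum>p<N. a p q) * (y q)\<^sup>2)"
    by (simp add: sum_distrib_left sum_distrib_right) (rule sum.swap)
  also have "\<dots> \<le> s * (\<Sum>q<N. s * (y q)\<^sup>2)"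
    using col assms(2) by (intro mult_left_mono sum_mono mult_right_mono) (auto simp: a_def)
  also have "\<dots> = s\<^sup>2 * (\<Sum>q<N. (y q)\<^sup>2)"
    by (simp add: sum_distrib_left power2_eq_square mult.assoc)
  also have "\<dots> \<le> s\<^sup>2 * 1"
    by (intro mult_left_mono y1) auto
  finally show "x \<le> s"
    by (intro power2_le_imp_le[OF _ assms(2)]) simp
qed


section \<open>Fourier coefficients of trigonometric polynomials\<close>

text \<open>Fubini for a product of one-variable functions, after writing \<open>lborel\<close> as
  the image of the product of the coordinate measures.\<close>

lemma integral_lborel_prod:
  fixes g :: "'a::euclidean_space \<Rightarrow> real \<Rightarrow> complex"
  assumes int: "\<And>b. b \<in> Basis \<Longrightarrow> integrable lborel (g b)"
  shows "(LINT x|lborel. (\<Prod>b\<in>Basis. g b (x \<bullet> b))) = (\<Prod>b\<in>Basis. LINT t|lborel. g b t)"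
proof -
  interpret product_sigma_finite "\<lambda>_::'a. lborel::real measure" ..
  have meas [measurable]: "g b \<in> borel_measurable borel" if "b \<in> Basis" for b
    using borel_measurable_integrable[OF int[OF that]] by simp
  have "(LINT x|lborel. (\<Prod>b\<in>Basis. g b (x \<bullet> b))) =
      (LINT x|(\<Pi>\<^sub>M b\<in>Basis. lborel). (\<Prod>b\<in>Basis. g b ((\<Sum>b\<in>Basis. x b *\<^sub>R b) \<bullet> b)))"
    by (subst lborel_eq) (intro integral_distr; measurable)
  also have "\<dots> = (LINT x|(\<Pi>\<^sub>M b\<in>Basis. lborel). (\<Prod>b\<in>Basis. g b (x b)))"
    by (intro Bochner_Integration.integral_cong prod.cong) simp_all
  also have "\<dots> = (\<Prod>b\<in>Basis. LINT t|lborel. g b t)"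
    by (rule product_integral_prod) (simp_all add: int)
  finally show ?thesis .
qed

lemma integral_exp_int:
  "(LINT t|lborel. indicator {-pi..pi} t *\<^sub>R exp (\<i> * complex_of_real (of_int m * t))) =
     (if m = 0 then 2 * pi else 0)"
proof (cases "m = 0")
  case True
  then show ?thesis by (simp add: scaleR_conv_of_real)
next
  case False
  define F where "F = (\<lambda>t. exp (\<i> * complex_of_real (of_int m * t)) / (\<i> * of_int m))"
  have "(LINT t|lborel. indicator {-pi..pi} t *\<^sub>R exp (\<i> * complex_of_real (of_int m * t))) = F pi - F (-pi)"
  proof (rule integral_FTC_Icc)
    fix t
    have "((\<lambda>z. exp (\<i> * of_int m * z) / (\<i> * of_int m)) has_field_derivative exp (\<i> * of_int m * of_real t))
        (at (complex_of_real t))"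
      using False by (auto intro!: derivative_eq_intros)
    from has_vector_derivative_real_field[OF this]
    show "(F has_vector_derivative exp (\<i> * complex_of_real (of_int m * t))) (at t within {-pi..pi})"
      by (simp add: F_def mult.assoc)
  next
    show "continuous_on {-pi..pi} (\<lambda>t. exp (\<i> * complex_of_real (of_int m * t)))"
      by (intro continuous_intros)
  qed simp
  also have "F pi = F (-pi)"
  proof -
    \<comment> \<open>The antiderivative takes equal values at both ends: the cosine is even and the
      sine vanishes at integer multiples of pi.\<close>
    have "cis (of_int m * pi) = cis (of_int m * (-pi))"
      using sin_integer_2pi[of "of_int m"] sin_zero_iff_int2[of "of_int m * pi"] by (auto simp: complex_eq_iff)
    then show ?thesis unfolding F_def cis_conv_exp by simp
  qed
  finally show ?thesis using False by simp
qed

text \<open>Orthogonality of the characters: the indicator of the cube and the exponential both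
  factor over the coordinates, so one vanishing one-dimensional integral suffices.\<close>

lemma integral_freq_cube_exp:
  fixes k :: "int^'d::finite"
  shows "(LINT \<theta>:freq_cube|lborel. exp (\<i> * complex_of_real (rvec k \<bullet> \<theta>))) =
     (if k = 0 then complex_of_real ((2 * pi) ^ CARD('d)) else 0)"
proof -
  define g where "g = (\<lambda>(b::real^'d) t. indicator {-pi..pi} t *\<^sub>R exp (\<i> * complex_of_real ((rvec k \<bullet> b) * t)))"
  have ind: "indicator freq_cube \<theta> = (\<Prod>b\<in>Basis. indicator {-pi..pi} (\<theta> \<bullet> b) :: real)" for \<theta> :: "real^'d"
  proof -
    have mem: "\<theta> \<in> freq_cube \<longleftrightarrow> (\<forall>b\<in>Basis. \<theta> \<bullet> b \<in> {-pi..pi})"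
      by (auto simp: mem_box Basis_vec_def inner_axis)
    show ?thesis
    proof (cases "\<theta> \<in> freq_cube")
      case True
      then have "(\<Prod>b\<in>Basis. indicator {-pi..pi} (\<theta> \<bullet> b) :: real) = 1"
        unfolding mem by (intro prod.neutral) simp
      then show ?thesis using True by simp
    next
      case False
      then have "(\<Prod>b\<in>Basis. indicator {-pi..pi} (\<theta> \<bullet> b) :: real) = 0"
        unfolding mem by (intro prod_zero) (auto simp del: atLeastAtMost_iff intro!: bexI)
      then show ?thesis using False by simp
    qed
  qed
  have "(LINT \<theta>:freq_cube|lborel. exp (\<i> * complex_of_real (rvec k \<bullet> \<theta>))) =
      (LINT \<theta>|lborel. (\<Prod>b\<in>Basis. g b (\<theta> \<bullet> b)))"
    unfolding set_lebesgue_integral_def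
  proof (rule Bochner_Integration.integral_cong)
    fix \<theta> :: "real^'d"
    have "exp (\<i> * complex_of_real (rvec k \<bullet> \<theta>)) = (\<Prod>b\<in>Basis. exp (\<i> * complex_of_real ((rvec k \<bullet> b) * (\<theta> \<bullet> b))))"
      by (subst euclidean_inner) (simp add: exp_sum sum_distrib_left)
    then show "indicator freq_cube \<theta> *\<^sub>R exp (\<i> * complex_of_real (rvec k \<bullet> \<theta>)) = (\<Prod>b\<in>Basis. g b (\<theta> \<bullet> b))"
      unfolding g_def ind by (simp add: scaleR_conv_of_real prod.distrib)
  qed simp
  also have "\<dots> = (\<Prod>b\<in>Basis. LINT t|lborel. g b t)"
  proof (rule integral_lborel_prod)
    show "integrable lborel (g b)" for b
      unfolding g_def set_integrable_def[symmetric]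
      by (intro borel_integrable_atLeastAtMost' continuous_intros)
  qed
  also have "\<dots> = (\<Prod>l\<in>UNIV. LINT t|lborel. g (axis l 1) t)"
    by (rule prod.reindex_cong[of "\<lambda>l. axis l 1"])
       (auto simp: inj_on_def axis_eq_axis Basis_vec_def)
  also have "\<dots> = (\<Prod>l\<in>UNIV. if k $ l = 0 then 2 * pi else 0)"
    unfolding g_def using integral_exp_int[of "k $ _"]
    by (auto simp: inner_axis rvec_def intro!: prod.cong)
  also have "\<dots> = (if k = 0 then complex_of_real ((2 * pi) ^ CARD('d)) else 0)"
    by (auto simp: prod_zero_iff Finite_Cartesian_Product.vec_eq_iff)
  finally show ?thesis .
qed

text \<open>Multiplying by the conjugate character shifts every frequency by \<open>j\<close>; by
  orthogonality only the term with frequency \<open>j\<close> survives.\<close>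

lemma fourier_coeff_trig_poly:
  fixes c :: "int^'d::finite \<Rightarrow> complex"
  assumes "finite K"
  shows "fourier_coeff (\<lambda>\<theta>. \<Sum>k\<in>K. c k * exp (\<i> * complex_of_real (rvec k \<bullet> \<theta>))) j = (if j \<in> K then c j else 0)"
proof -
  have "(LINT \<theta>:freq_cube|lborel. (\<Sum>k\<in>K. c k * exp (\<i> * complex_of_real (rvec k \<bullet> \<theta>))) *
       exp (- (\<i> * complex_of_real (rvec j \<bullet> \<theta>)))) =
     (LINT \<theta>:freq_cube|lborel. (\<Sum>k\<in>K. c k * exp (\<i> * complex_of_real (rvec (k - j) \<bullet> \<theta>))))"
  proof (intro set_lebesgue_integral_cong allI impI)
    fix \<theta> :: "real^'d"
    have r: "rvec (k - j) = rvec k - rvec j" for k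
      by (simp add: rvec_def Finite_Cartesian_Product.vec_eq_iff)
    show "(\<Sum>k\<in>K. c k * exp (\<i> * complex_of_real (rvec k \<bullet> \<theta>))) * exp (- (\<i> * complex_of_real (rvec j \<bullet> \<theta>))) =
       (\<Sum>k\<in>K. c k * exp (\<i> * complex_of_real (rvec (k - j) \<bullet> \<theta>)))"
      unfolding r sum_distrib_right
      by (intro sum.cong) (simp_all add: inner_diff_left right_diff_distrib exp_diff exp_minus divide_inverse)
  qed simp
  also have "\<dots> = (\<Sum>k\<in>K. LINT \<theta>:freq_cube|lborel. c k * exp (\<i> * complex_of_real (rvec (k - j) \<bullet> \<theta>)))"
    unfolding set_lebesgue_integral_def scaleR_sum_right
  proof (rule Bochner_Integration.integral_sum)
    fix k
    have "continuous_on freq_cube (\<lambda>\<theta>::real^'d. c k * exp (\<i> * complex_of_real (rvec (k - j) \<bullet> \<theta>)))"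
      by (intro continuous_intros)
    then show "integrable lborel (\<lambda>\<theta>. indicator freq_cube \<theta> *\<^sub>R (c k * exp (\<i> * complex_of_real (rvec (k - j) \<bullet> \<theta>))))"
      using borel_integrable_compact[of freq_cube] by simp
  qed
  also have "\<dots> = (\<Sum>k\<in>K. if k = j then c j * complex_of_real ((2 * pi) ^ CARD('d)) else 0)"
    by (intro sum.cong) (auto simp: integral_freq_cube_exp)
  finally show ?thesis using assms by (simp add: fourier_coeff_def sum.delta)
qed


section \<open>Smoothness of polynomials\<close>

lemma Ck_on_const: "Ck_on k S (\<lambda>x. c)"
  by (induction k arbitrary: c) (auto intro!: exI[of _ "\<lambda>_ _. 0"])

lemma Ck_on_SucE:
  assumes "Ck_on (Suc k) S f"
  obtains D where
    "\<And>x. x \<in> interior S \<Longrightarrow> (f has_derivative (\<lambda>v. \<Sum>l\<in>UNIV. v $ l *\<^sub>R D l x)) (at x)"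
    "\<And>l. Ck_on k S (D l)"
  using assms by (simp only: Ck_on.simps) blast

lemma Ck_on_SucD: "Ck_on (Suc k) S f \<Longrightarrow> Ck_on k S f"
proof (induction k arbitrary: f)
  case (Suc k)
  obtain D where D: "\<And>x. x \<in> interior S \<Longrightarrow> (f has_derivative (\<lambda>v. \<Sum>l\<in>UNIV. v $ l *\<^sub>R D l x)) (at x)"
      "\<And>l. Ck_on (Suc k) S (D l)"
    using Ck_on_SucE[OF Suc.prems] by blast
  have "continuous_on S f" using Suc.prems unfolding Ck_on.simps(2)[of "Suc k"] by blast
  then show ?case unfolding Ck_on.simps(2)[of k] using D(1) Suc.IH[OF D(2)] by blast
qed simp

text \<open>The partial derivatives of a linear map are the constants \<open>h (axis l 1)\<close>,
  and constants have every order of smoothness.\<close>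

lemma Ck_on_bounded_linear:
  fixes h :: "real^'d::finite \<Rightarrow> 'b::real_normed_vector"
  assumes "bounded_linear h"
  shows "Ck_on k S h"
proof (cases k)
  case (Suc k')
  have "h v = (\<Sum>l\<in>UNIV. v $ l *\<^sub>R h (axis l 1))" for v
  proof -
    have "h v = h (\<Sum>l\<in>UNIV. v $ l *\<^sub>R axis l 1)"
      using basis_expansion[of v] by (simp add: scalar_mult_eq_scaleR)
    then show ?thesis
      using bounded_linear.linear[OF assms] by (simp add: linear_sum linear_cmul)
  qed
  then have heq: "(\<lambda>v. \<Sum>l\<in>UNIV. v $ l *\<^sub>R h (axis l 1)) = h" by (intro ext) (rule sym)
  have "(h has_derivative (\<lambda>v. \<Sum>l\<in>UNIV. v $ l *\<^sub>R h (axis l 1))) (at x)" for x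
    unfolding heq by (rule bounded_linear_imp_has_derivative[OF assms])
  then show ?thesis unfolding Suc
    using bounded_linear.continuous_on[OF assms continuous_on_id]
    by (auto intro!: exI[of _ "\<lambda>l _. h (axis l 1)"] Ck_on_const)
qed (simp add: bounded_linear.continuous_on[OF assms continuous_on_id])

lemma Ck_on_add:
  "Ck_on k S f \<Longrightarrow> Ck_on k S g \<Longrightarrow> Ck_on k S (\<lambda>x. f x + g x)"
proof (induction k arbitrary: f g)
  case (Suc k)
  obtain D where D: "\<And>x. x \<in> interior S \<Longrightarrow> (f has_derivative (\<lambda>v. \<Sum>l\<in>UNIV. v $ l *\<^sub>R D l x)) (at x)"
      "\<And>l. Ck_on k S (D l)"
    using Ck_on_SucE[OF Suc.prems(1)] by blast
  obtain E where E: "\<And>x. x \<in> interior S \<Longrightarrow> (g has_derivative (\<lambda>v. \<Sum>l\<in>UNIV. v $ l *\<^sub>R E l x)) (at x)"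
      "\<And>l. Ck_on k S (E l)"
    using Ck_on_SucE[OF Suc.prems(2)] by blast
  have "((\<lambda>x. f x + g x) has_derivative (\<lambda>v. \<Sum>l\<in>UNIV. v $ l *\<^sub>R (D l x + E l x))) (at x)" if "x \<in> interior S" for x
    using has_derivative_add[OF D(1)[OF that] E(1)[OF that]] by (simp add: scaleR_add_right sum.distrib)
  then show ?case
    using Suc.prems Suc.IH[OF D(2) E(2)]
    by (auto intro!: continuous_on_add exI[of _ "\<lambda>l x. D l x + E l x"])
qed (auto intro: continuous_on_add)

text \<open>Product rule. The derivatives contain \<open>f\<close> and \<open>g\<close> themselves,
  so the induction also uses that smoothness of order \<open>Suc k\<close> implies order
  \<open>k\<close>.\<close>

lemma Ck_on_mult:
  fixes f g :: "real^'d::finite \<Rightarrow> 'b::real_normed_field"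
  shows "Ck_on k S f \<Longrightarrow> Ck_on k S g \<Longrightarrow> Ck_on k S (\<lambda>x. f x * g x)"
proof (induction k arbitrary: f g)
  case (Suc k)
  obtain D where D: "\<And>x. x \<in> interior S \<Longrightarrow> (f has_derivative (\<lambda>v. \<Sum>l\<in>UNIV. v $ l *\<^sub>R D l x)) (at x)"
      "\<And>l. Ck_on k S (D l)"
    using Ck_on_SucE[OF Suc.prems(1)] by blast
  obtain E where E: "\<And>x. x \<in> interior S \<Longrightarrow> (g has_derivative (\<lambda>v. \<Sum>l\<in>UNIV. v $ l *\<^sub>R E l x)) (at x)"
      "\<And>l. Ck_on k S (E l)"
    using Ck_on_SucE[OF Suc.prems(2)] by blast
  have "((\<lambda>x. f x * g x) has_derivative (\<lambda>v. \<Sum>l\<in>UNIV. v $ l *\<^sub>R (f x * E l x + D l x * g x))) (at x)"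
    if "x \<in> interior S" for x
    using has_derivative_mult[OF D(1)[OF that] E(1)[OF that]]
    by (simp add: scaleR_add_right sum.distrib sum_distrib_left sum_distrib_right)
  moreover have "Ck_on k S (\<lambda>x. f x * E l x + D l x * g x)" for l
    using Suc.prems[THEN Ck_on_SucD] by (intro Ck_on_add Suc.IH D(2) E(2))
  ultimately show ?case
    using Suc.prems by (auto intro!: continuous_on_mult exI[of _ "\<lambda>l x. f x * E l x + D l x * g x"])
qed (auto intro: continuous_on_mult)

text \<open>Makes the polynomials from the Stone-Weierstrass theorem admissible as the smooth
  weights in the definition of \<open>glt\<close>.\<close>

lemma Cinf_on_real_polynomial_function:
  fixes p :: "real^'d::finite \<Rightarrow> real"
  assumes "real_polynomial_function p"
  shows "Cinf_on S (\<lambda>x. complex_of_real (p x))"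
  unfolding Cinf_on_def using assms
proof (induction rule: real_polynomial_function.induct)
  case (linear h)
  then show ?case
    by (blast intro: Ck_on_bounded_linear bounded_linear_compose bounded_linear_of_real)
qed (auto simp: Ck_on_const Ck_on_add Ck_on_mult)


section \<open>Multilevel matrices\<close>

text \<open>A matrix given by a kernel on multi-indices. The extended matrix, the GLT approximants
  and both error terms take this form, so estimates can ignore list positions.\<close>

definition multilevel_mat ::
  "int^'d::{finite,linorder} \<Rightarrow> (int^'d::{finite,linorder} \<Rightarrow> int^'d::{finite,linorder} \<Rightarrow> complex) \<Rightarrow> complex mat" where
  "multilevel_mat n f = Matrix.mat (msize n) (msize n) (\<lambda>(p, q). f (lex_list {1..n} ! p) (lex_list {1..n} ! q))"

lemma multilevel_mat_carrier: "multilevel_mat n f \<in> carrier_mat (msize n) (msize n)"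
  by (simp add: multilevel_mat_def)

lemma multilevel_mat_add: "multilevel_mat n f + multilevel_mat n g = multilevel_mat n (\<lambda>j i. f j i + g j i)"
  by (intro eq_matI) (auto simp: multilevel_mat_def)

lemma mat_sum_carrier:
  "(\<And>l. l < r \<Longrightarrow> F l \<in> carrier_mat N N) \<Longrightarrow> mat_sum N F r \<in> carrier_mat N N"
proof -
  have "foldr (\<lambda>l M. F l + M) ls (0\<^sub>m N N) \<in> carrier_mat N N"
    if "\<forall>l\<in>set ls. F l \<in> carrier_mat N N" for ls
    using that by (induction ls) auto
  then show "(\<And>l. l < r \<Longrightarrow> F l \<in> carrier_mat N N) \<Longrightarrow> mat_sum N F r \<in> carrier_mat N N"
    by (simp add: mat_sum_def)
qed

lemma mat_sum_index:
  assumes "\<And>l. l < r \<Longrightarrow> F l \<in> carrier_mat N N" "p < N" "q < N"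
  shows "mat_sum N F r $$ (p, q) = (\<Sum>l<r. F l $$ (p, q))"
proof -
  have "foldr (\<lambda>l M. F l + M) ls (0\<^sub>m N N) \<in> carrier_mat N N \<and>
      foldr (\<lambda>l M. F l + M) ls (0\<^sub>m N N) $$ (p, q) = (\<Sum>l\<leftarrow>ls. F l $$ (p, q))"
    if "\<forall>l\<in>set ls. F l \<in> carrier_mat N N" for ls
    using that assms(2,3) by (induction ls) auto
  from this[of "[0..<r]"] show ?thesis
    using assms(1) by (simp add: mat_sum_def interv_sum_list_conv_sum_set_nat lessThan_atLeast0)
qed

locale multi_index =
  fixes n :: "int^'d::{finite,linorder}"
  assumes nonneg: "0 \<le> n $ k"
begin

lemma bij_betw_positions: "bij_betw ((!) (lex_list {1..n})) {..<msize n} {1..n}"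
  using bij_betw_lex_list[OF finite_multi_index, of 1 n] card_multi_index[OF nonneg] by simp

lemma nth_lex_list_mem: "p < msize n \<Longrightarrow> lex_list {1..n} ! p \<in> {1..n}"
  using bij_betw_apply[OF bij_betw_positions] by simp

lemma nth_lex_list_eq_iff:
  "p < msize n \<Longrightarrow> q < msize n \<Longrightarrow> lex_list {1..n} ! p = lex_list {1..n} ! q \<longleftrightarrow> p = q"
  using inj_on_eq_iff[OF bij_betw_imp_inj_on[OF bij_betw_positions]] by simp

lemma diag_times_toeplitz:
  "diag_sampling_mat a n * toeplitz_mat f n =
     multilevel_mat n (\<lambda>j i. a (\<chi> k. of_int (j $ k) / of_int (n $ k)) * fourier_coeff f (j - i))"
  (is "?D * ?T = ?M")
proof (rule eq_matI)
  fix p q assume "p < dim_row ?M" "q < dim_col ?M"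
  then have pq: "p < msize n" "q < msize n" by (simp_all add: multilevel_mat_def)
  then have "(?D * ?T) $$ (p, q) = (\<Sum>r<msize n. ?D $$ (p, r) * ?T $$ (r, q))"
    by (auto simp: scalar_prod_def diag_sampling_mat_def toeplitz_mat_def Let_def lessThan_atLeast0 intro!: sum.cong)
  also have "\<dots> = (\<Sum>r<msize n. if r = p then ?D $$ (p, p) * ?T $$ (p, q) else 0)"
    using pq by (intro sum.cong) (auto simp: diag_sampling_mat_def Let_def)
  also have "\<dots> = ?M $$ (p, q)"
    using pq by (simp add: sum.delta multilevel_mat_def diag_sampling_mat_def toeplitz_mat_def Let_def)
  finally show "(?D * ?T) $$ (p, q) = ?M $$ (p, q)" .
qed (simp_all add: multilevel_mat_def diag_sampling_mat_def toeplitz_mat_def Let_def)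

lemma mat_sum_diag_times_toeplitz:
  "mat_sum (msize n) (\<lambda>l. diag_sampling_mat (a l) n * toeplitz_mat (f l) n) r =
     multilevel_mat n (\<lambda>j i. \<Sum>l<r. a l (\<chi> k. of_int (j $ k) / of_int (n $ k)) * fourier_coeff (f l) (j - i))"
  (is "?S = ?M")
proof -
  have c: "diag_sampling_mat (a l) n * toeplitz_mat (f l) n \<in> carrier_mat (msize n) (msize n)" for l
    unfolding diag_times_toeplitz by (rule multilevel_mat_carrier)
  show ?thesis
  proof (rule eq_matI)
    fix p q assume "p < dim_row ?M" "q < dim_col ?M"
    then have pq: "p < msize n" "q < msize n" by (simp_all add: multilevel_mat_def)
    then show "?S $$ (p, q) = ?M $$ (p, q)"
      by (subst mat_sum_index[OF c pq]) (simp_all add: diag_times_toeplitz multilevel_mat_def)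
  qed (simp_all only: carrier_matD[OF mat_sum_carrier[OF c]] carrier_matD[OF multilevel_mat_carrier])
qed

text \<open>Schur's test, with sums over positions transported to sums over multi-indices by the
  enumeration bijection.\<close>

lemma spectral_norm_multilevel_mat_le:
  assumes "0 \<le> s"
    and row: "\<And>j. j \<in> {1..n} \<Longrightarrow> (\<Sum>i\<in>{1..n}. cmod (f j i)) \<le> s"
    and col: "\<And>i. i \<in> {1..n} \<Longrightarrow> (\<Sum>j\<in>{1..n}. cmod (f j i)) \<le> s"
  shows "spectral_norm (multilevel_mat n f) \<le> s"
proof (rule schur_test[OF multilevel_mat_carrier assms(1)])
  have reindex: "(\<Sum>p<msize n. g (lex_list {1..n} ! p)) = (\<Sum>j\<in>{1..n}. g j)" for g :: "_ \<Rightarrow> real"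
    using sum.reindex_bij_betw[OF bij_betw_positions] .
  show "(\<Sum>q<msize n. cmod (multilevel_mat n f $$ (p, q))) \<le> s" if "p < msize n" for p
    using row[OF nth_lex_list_mem[OF that]] that reindex[of "\<lambda>i. cmod (f (lex_list {1..n} ! p) i)"]
    by (simp add: multilevel_mat_def)
  show "(\<Sum>p<msize n. cmod (multilevel_mat n f $$ (p, q))) \<le> s" if "q < msize n" for q
    using col[OF nth_lex_list_mem[OF that]] that reindex[of "\<lambda>j. cmod (f j (lex_list {1..n} ! q))"]
    by (simp add: multilevel_mat_def)
qed

lemma rank_multilevel_mat_le:
  assumes "B \<subseteq> {1..n}" and "\<And>j i. j \<in> {1..n} - B \<Longrightarrow> i \<in> {1..n} \<Longrightarrow> f j i = 0"
  shows "vec_space.rank (msize n) (multilevel_mat n f) \<le> card B"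
proof -
  define P where "P = {p. p < msize n \<and> lex_list {1..n} ! p \<in> B}"
  have "vec_space.rank (msize n) (multilevel_mat n f) \<le> card P"
    by (rule rank_le_card_nonzero_rows[OF _ multilevel_mat_carrier])
      (use assms(2) nth_lex_list_mem in \<open>auto simp: P_def multilevel_mat_def\<close>)
  also have "card P = card ((!) (lex_list {1..n}) ` P)"
    by (rule card_image[symmetric]) (auto simp: inj_on_def P_def nth_lex_list_eq_iff)
  also have "\<dots> \<le> card B"
    by (rule card_mono) (auto simp: P_def intro: finite_subset[OF assms(1) finite_multi_index])
  finally show ?thesis .
qed

text \<open>\<open>submatrix\<close> picks the selected positions in increasing order, hence its
  rows follow \<open>nths\<close> of the full list, which is the lexicographic list of the selected
  multi-indices.\<close>

lemma restr_multilevel_mat: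
  fixes U :: "(real^'d::{finite,linorder}) set"
  defines "js \<equiv> lex_list {j \<in> {1..n}. grid_pt n (rvec j) \<in> U}"
  shows "restr_mat U n (multilevel_mat n f) =
    Matrix.mat (length js) (length js) (\<lambda>(p, q). f (js ! p) (js ! q))"
proof -
  let ?I = "restr_positions U n"
  have js: "js = nths (lex_list {1..n}) ?I"
    unfolding js_def
  proof (rule nths_lex_list[OF finite_multi_index, symmetric])
    have "(!) (lex_list {1..n}) ` {..<msize n} = {1..n}"
      using bij_betw_positions by (rule bij_betw_imp_surj_on)
    then show "{j \<in> {1..n}. grid_pt n (rvec j) \<in> U} =
        {lex_list {1..n} ! p |p. p < card {1..n} \<and> p \<in> ?I}"
      unfolding restr_positions_def card_multi_index[OF nonneg] by force
  qed
  have len: "length (lex_list {1..n}) = msize n"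
    by (simp add: length_lex_list finite_multi_index card_multi_index nonneg)
  have card: "length js = card {p. p < msize n \<and> p \<in> ?I}"
    by (simp add: js length_nths len)
  have nth: "js ! p = lex_list {1..n} ! pick ?I p" if "p < length js" for p
    using that nth_nths[of p "lex_list {1..n}" ?I] unfolding card by (simp add: len js)
  show ?thesis
    unfolding restr_mat_def submatrix_def
    by (rule eq_matI)
      (auto simp: multilevel_mat_def card[symmetric] nth pick_le[of _ "msize n" ?I, folded card])
qed

end


section \<open>Counting grid points\<close>

text \<open>The boxes of side lengths \<open>step n k\<close> with upper corners at the grid points are disjoint.\<close>

lemma card_grid_le:
  fixes n :: "int^'d::finite"
  assumes nonneg: "\<And>k. 0 \<le> n $ k" and S: "finite S"
    and small: "\<And>k. step n k \<le> e / CARD('d)"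
    and F: "F \<in> lmeasurable" and ball: "\<And>j. j \<in> S \<Longrightarrow> cball (grid_pt n (rvec j)) e \<subseteq> F"
  shows "real (card S) \<le> measure lebesgue F * (\<Prod>k\<in>UNIV. of_int (n $ k) + 1)"
proof -
  define h :: "real^'d" where "h = (\<chi> k. step n k)"
  define C where "C = (\<lambda>j::int^'d. box (grid_pt n (rvec j) - h) (grid_pt n (rvec j)))"
  have h: "0 < h $ k" for k using nonneg[of k] by (simp add: h_def step_def)
  have x: "grid_pt n (rvec j) $ k = of_int (j $ k) * h $ k" for j k
    by (simp add: grid_pt_def rvec_def h_def)
  have "disjoint_family_on C S"
    unfolding disjoint_family_on_def
  proof (intro ballI impI, rule ccontr)
    fix i j assume "i \<noteq> j" "C i \<inter> C j \<noteq> {}"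
    then obtain y where y: "y \<in> C i" "y \<in> C j" by blast
    \<comment> \<open>A common point lies above \<open>(i $ k - 1) * h $ k\<close> and below
      \<open>j $ k * h $ k\<close>; integrality gives one inequality, and exchanging
      \<open>i\<close> and \<open>j\<close> the other.\<close>
    have "i $ k \<le> j $ k" if "y \<in> C i" "y \<in> C j" for i j k
    proof -
      have "of_int (i $ k) * h $ k - h $ k < of_int (j $ k) * h $ k"
        using that by (auto simp: C_def mem_box_cart x intro: less_trans)
      then have "(of_int (i $ k) - 1) * h $ k < of_int (j $ k) * h $ k" by (simp add: algebra_simps)
      then show ?thesis using h[of k] by simp
    qed
    then have "i = j" using y by (auto simp: Finite_Cartesian_Product.vec_eq_iff intro: antisym)
    then show False using \<open>i \<noteq> j\<close> by simp
  qed
  moreover have meas: "C j \<in> sets lebesgue" for j by (simp add: C_def)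
  moreover have vol: "measure lebesgue (C j) = (\<Prod>k\<in>UNIV. h $ k)" for j
  proof -
    have "measure lebesgue (C j) = measure lborel (cbox (grid_pt n (rvec j) - h) (grid_pt n (rvec j)))"
      by (simp add: C_def measure_lborel_box_eq measure_lborel_cbox_eq)
    also have "\<dots> = (\<Prod>k\<in>UNIV. h $ k)"
      by (subst content_cbox_cart) (auto simp: interval_ne_empty_cart less_imp_le h)
    finally show ?thesis .
  qed
  moreover have "emeasure lebesgue (C j) \<noteq> \<infinity>" for j
    using emeasure_lborel_box_finite[of "grid_pt n (rvec j) - h" "grid_pt n (rvec j)"] by (simp add: C_def)
  ultimately have "measure lebesgue (\<Union>j\<in>S. C j) = real (card S) * (\<Prod>k\<in>UNIV. h $ k)"
    using S by (subst measure_finite_Union) auto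
  moreover have "measure lebesgue (\<Union>j\<in>S. C j) \<le> measure lebesgue F"
  proof (rule measure_mono_fmeasurable[OF _ _ F])
    \<comment> \<open>The Euclidean norm is bounded by the sum of the coordinates' moduli; the
      divisor \<open>CARD('d)\<close> in the bound on the steps compensates for the number of
      summands.\<close>
    have "y \<in> cball (grid_pt n (rvec j)) e" if "y \<in> C j" for y j
    proof -
      have "norm (y - grid_pt n (rvec j)) \<le> (\<Sum>k\<in>UNIV. \<bar>(y - grid_pt n (rvec j)) $ k\<bar>)"
        by (rule norm_le_l1_cart)
      also have "\<dots> \<le> (\<Sum>k\<in>(UNIV::'d set). e / CARD('d))"
      proof (rule sum_mono)
        fix k
        have "grid_pt n (rvec j) $ k - h $ k < y $ k" "y $ k < grid_pt n (rvec j) $ k"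
          using that by (auto simp: C_def mem_box_cart)
        then show "\<bar>(y - grid_pt n (rvec j)) $ k\<bar> \<le> e / CARD('d)"
          using small[of k] by (simp add: h_def)
      qed
      finally show ?thesis by (simp add: dist_norm norm_minus_commute)
    qed
    then show "(\<Union>j\<in>S. C j) \<subseteq> F" using ball by blast
    show "(\<Union>j\<in>S. C j) \<in> sets lebesgue" using S meas by (intro sets.finite_UN) auto
  qed
  ultimately have le: "real (card S) * (\<Prod>k\<in>UNIV. h $ k) \<le> measure lebesgue F" by simp
  have pos: "0 < real_of_int (n $ k) + 1" for k using nonneg[of k] by (simp add: add_nonneg_pos)
  then have "h $ k * (of_int (n $ k) + 1) = 1" for k
    using less_imp_neq[OF pos[of k]] by (simp add: h_def step_def)
  then have "(\<Prod>k\<in>UNIV. h $ k) * (\<Prod>k\<in>UNIV. of_int (n $ k) + 1) = 1"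
    by (simp add: prod.distrib[symmetric])
  then have "real (card S) = real (card S) * (\<Prod>k\<in>UNIV. h $ k) * (\<Prod>k\<in>UNIV. of_int (n $ k) + 1)"
    by (simp add: mult.assoc)
  also have "\<dots> \<le> measure lebesgue F * (\<Prod>k\<in>UNIV. of_int (n $ k) + 1)"
    by (intro mult_right_mono le prod_nonneg) (simp add: less_imp_le pos)
  finally show ?thesis .
qed

text \<open>The volume bound involves the product of the \<open>n $ k + 1\<close>. A nonempty
  \<open>S\<close> forces every component to be at least 1, so each factor is at most twice
  \<open>n $ k\<close>, whence the power of 2.\<close>

lemma card_grid_le_msize:
  fixes n :: "int^'d::finite"
  assumes nonneg: "\<And>k. 0 \<le> n $ k" and S: "S \<subseteq> {1..n}"
    and small: "\<And>k. step n k \<le> e / CARD('d)"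
    and F: "F \<in> lmeasurable" and ball: "\<And>j. j \<in> S \<Longrightarrow> cball (grid_pt n (rvec j)) e \<subseteq> F"
  shows "real (card S) \<le> 2 ^ CARD('d) * measure lebesgue F * msize n"
proof (cases "S = {}")
  case False
  then have "1 \<le> n" using S by (auto intro: order_trans)
  then have n: "1 \<le> n $ k" for k by (simp add: Finite_Cartesian_Product.less_eq_vec_def)
  have "real (card S) \<le> measure lebesgue F * (\<Prod>k\<in>UNIV. of_int (n $ k) + 1)"
    by (rule card_grid_le[OF nonneg finite_subset[OF S finite_multi_index] small F ball])
  also have "\<dots> \<le> measure lebesgue F * (2 ^ CARD('d) * real (msize n))"
  proof (rule mult_left_mono)
    have "(\<Prod>k\<in>UNIV. real_of_int (n $ k) + 1) \<le> (\<Prod>k\<in>UNIV. 2 * of_int (n $ k))"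
      using n by (intro prod_mono) (simp add: order_trans[OF _ n])
    also have "\<dots> = 2 ^ CARD('d) * real (msize n)"
      using nonneg by (simp add: prod.distrib msize_def prod_nonneg)
    finally show "(\<Prod>k\<in>UNIV. real_of_int (n $ k) + 1) \<le> 2 ^ CARD('d) * real (msize n)" .
  qed simp
  finally show ?thesis by (simp add: mult_ac)
qed simp

text \<open>The closed neighbourhoods are compact, hence of finite measure, and decrease to the null
  set \<open>F\<close>; continuity of the measure from above applies.\<close>

lemma measure_infdist_tendsto_0:
  fixes F :: "(real^'d::finite) set"
  assumes "compact F" "F \<noteq> {}" "F \<in> null_sets lebesgue" and "decseq r" "\<And>m. 0 < r m" "r \<longlonglongrightarrow> 0"
  shows "(\<lambda>m. measure lebesgue {x. infdist x F \<le> r m}) \<longlonglongrightarrow> 0"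
proof -
  define Z where "Z = (\<lambda>m::nat. {x. infdist x F \<le> r m})"
  have c: "compact (Z m)" for m
    unfolding Z_def by (intro compact_infdist_le assms)
  have "(\<Inter>m. Z m) = F"
  proof
    show "(\<Inter>m. Z m) \<subseteq> F"
    proof
      fix x assume "x \<in> (\<Inter>m. Z m)"
      then have "infdist x F \<le> 0"
        using assms(6) by (intro LIMSEQ_le_const[of r]) (auto simp: Z_def)
      then show "x \<in> F"
        using in_closed_iff_infdist_zero[OF compact_imp_closed[OF assms(1)] assms(2)] infdist_nonneg[of x F] by simp
    qed
    show "F \<subseteq> (\<Inter>m. Z m)" using assms(5) by (auto simp: Z_def less_imp_le)
  qed
  moreover have "(\<lambda>m. measure lebesgue (Z m)) \<longlonglongrightarrow> measure lebesgue (\<Inter>m. Z m)"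
  proof (rule Lim_measure_decseq)
    show "decseq Z" using assms(4) by (auto simp: decseq_def Z_def intro: order_trans)
    show "range Z \<subseteq> sets lebesgue" using lmeasurable_compact[OF c] by (auto simp: fmeasurableD)
    show "emeasure lebesgue (Z m) \<noteq> \<infinity>" for m
      using lmeasurable_compact[OF c[of m]] by (auto simp: fmeasurable_def)
  qed
  ultimately show ?thesis
    using assms(3) by (simp add: Z_def null_sets_def measure_def)
qed


section \<open>The Shortley--Weller stencil\<close>

text \<open>Euler's formula for the cosine; it exhibits the three frequencies of the one-directional
  second difference.\<close>

lemma laplace_symbol_eq_trig:
  fixes k :: "'d::finite"
  shows "(\<lambda>\<theta>::real^'d. complex_of_real (w * (2 - 2 * cos (\<theta> $ k)))) =
    (\<lambda>\<theta>. \<Sum>m\<in>{0, axis k 1, axis k (-1)}. (if m = 0 then 2 * complex_of_real w else - complex_of_real w) * exp (\<i> * complex_of_real (rvec m \<bullet> \<theta>)))"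
proof
  fix \<theta> :: "real^'d"
  have r: "rvec 0 = 0" "rvec (axis k s) = axis k (of_int s)" for s
    by (simp_all add: rvec_def Finite_Cartesian_Product.vec_eq_iff axis_def)
  have d: "axis k (1::int) \<noteq> 0" "axis k (-1::int) \<noteq> 0" "axis k (1::int) \<noteq> axis k (-1)"
    by (simp_all add: axis_eq_axis axis_eq_0_iff)
  have "complex_of_real (w * (2 - 2 * cos (\<theta> $ k))) = 2 * complex_of_real w - complex_of_real w * cis (\<theta> $ k) - complex_of_real w * cis (- \<theta> $ k)"
    by (simp add: complex_eq_iff algebra_simps)
  then show "complex_of_real (w * (2 - 2 * cos (\<theta> $ k))) =
    (\<Sum>m\<in>{0, axis k 1, axis k (-1)}. (if m = 0 then 2 * complex_of_real w else - complex_of_real w) * exp (\<i> * complex_of_real (rvec m \<bullet> \<theta>)))"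
    using d d(1,2)[symmetric] by (simp add: r inner_axis' cis_conv_exp)
qed

lemma trig_poly_laplace_symbol:
  "trig_poly (\<lambda>\<theta>::real^'d::finite. complex_of_real (w * (2 - 2 * cos (\<theta> $ k))))"
  unfolding trig_poly_def laplace_symbol_eq_trig
  by (intro exI[of _ "{0, axis k 1, axis k (-1)}"]
      exI[of _ "\<lambda>m. if m = 0 then 2 * complex_of_real w else - complex_of_real w"]) simp

lemma fourier_coeff_laplace_symbol:
  fixes i j :: "int^'d::finite"
  shows "fourier_coeff (\<lambda>\<theta>. complex_of_real (w * (2 - 2 * cos (\<theta> $ k)))) (j - i) =
    complex_of_real (w * (2 * of_bool (i = j) - (\<Sum>\<sigma>\<in>{1, -1}. of_bool (i = j + axis k \<sigma>))))"
proof -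
  have d: "axis k (1::int) \<noteq> 0" "axis k (-1::int) \<noteq> 0" "axis k (1::int) \<noteq> axis k (-1)"
    by (simp_all add: axis_eq_axis axis_eq_0_iff)
  have neg: "axis k (-1) = - axis k (1::int)"
    by (simp add: Finite_Cartesian_Product.vec_eq_iff axis_def)
  \<comment> \<open>The Toeplitz frequency \<open>j - i\<close> is opposite in sign to the neighbour
    direction \<open>i - j\<close>; this is harmless because both neighbours carry the same
    coefficient.\<close>
  have e: "j - i = 0 \<longleftrightarrow> i = j" "j - i = axis k 1 \<longleftrightarrow> i = j + axis k (-1)" "j - i = axis k (-1) \<longleftrightarrow> i = j + axis k 1"
    unfolding neg by (auto simp: algebra_simps)
  show ?thesis
    unfolding laplace_symbol_eq_trig
    by (subst fourier_coeff_trig_poly) (use d e in auto)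
qed

text \<open>A full step in either direction stays inside the ball of radius \<open>\<delta>\<close>
  and so never leaves \<open>W\<close>.\<close>

lemma sw_s_eq_1:
  assumes "ball (grid_pt n (rvec j)) \<delta> \<subseteq> W" "0 \<le> step n k" "step n k < \<delta>" "\<sigma> \<in> {1, -1}"
  shows "sw_s W n j k \<sigma> = 1"
proof -
  have "grid_pt n (rvec j) + (of_int \<sigma> * r * step n k) *\<^sub>R axis k 1 \<in> W" if "r \<in> {0..1}" for r
  proof -
    have "\<bar>of_int \<sigma> * r * step n k\<bar> \<le> 1 * step n k"
      using that assms(2,4) by (auto simp: abs_mult intro: mult_left_le_one_le)
    then have "dist (grid_pt n (rvec j)) (grid_pt n (rvec j) + (of_int \<sigma> * r * step n k) *\<^sub>R axis k 1) < \<delta>"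
      using assms(3) by (simp add: dist_norm norm_axis_1)
    then show ?thesis using assms(1) by (auto simp only: mem_ball)
  qed
  then have "{t \<in> {0..1}. \<forall>r\<in>{0..t}. grid_pt n (rvec j) + (of_int \<sigma> * r * step n k) *\<^sub>R axis k 1 \<in> W} = {0..1}"
    by (auto simp: Ball_def)
  then show ?thesis by (simp add: sw_s_def)
qed

text \<open>With all step fractions equal to 1 the denominators reduce to the squared step and twice
  the step. Indicators merge the diagonal and off-diagonal cases into one formula that can be
  compared termwise with the model.\<close>

lemma sw_entry_full_step:
  fixes n i j :: "int^'d::finite"
  assumes s: "\<And>k \<sigma>. \<sigma> \<in> {1, -1} \<Longrightarrow> sw_s W n j k \<sigma> = 1"
  defines "x \<equiv> \<lambda>k \<sigma>::int. grid_pt n (rvec j + (of_int \<sigma> / 2) *\<^sub>R axis k 1)"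
  shows "sw_entry a b c W n j i =
    of_bool (i = j) * (c (grid_pt n (rvec j)) + (\<Sum>k\<in>UNIV. \<Sum>\<sigma>\<in>{1, -1}. a k (x k \<sigma>) / (step n k)\<^sup>2)) -
    (\<Sum>k\<in>UNIV. \<Sum>\<sigma>\<in>{1, -1}. of_bool (i = j + axis k \<sigma>) *
       (a k (x k \<sigma>) / (step n k)\<^sup>2 - of_int \<sigma> * b k (grid_pt n (rvec j)) / (2 * step n k)))"
proof (cases "i = j")
  case True
  have "j \<noteq> j + axis k \<sigma>" if "\<sigma> \<in> {1, -1}" for k and \<sigma> :: int
    using that by (auto simp: axis_eq_0_iff)
  then show ?thesis using True s by (simp add: sw_entry_def x_def)
next
  case False
  have "sw_entry a b c W n j i = (\<Sum>k\<in>UNIV. \<Sum>\<sigma>\<in>{1, -1}. - (of_bool (i = j + axis k \<sigma>) *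
       (a k (x k \<sigma>) / (step n k)\<^sup>2 - of_int \<sigma> * b k (grid_pt n (rvec j)) / (2 * step n k))))"
    unfolding sw_entry_def if_not_P[OF False]
    by (intro sum.cong refl) (simp add: s s[of 1, simplified] s[of "-1", simplified] x_def)
  then show ?thesis using False by (simp only: sum_negf of_bool_eq mult_zero_left diff_0)
qed

text \<open>A kernel dominating the error entries: \<open>w k\<close> accounts for an error in the
  diffusion coefficient, the extra 1 on the diagonal for \<open>c\<close>, and the extra 1 at each
  neighbour for \<open>b\<close>.\<close>

definition stencil_weight :: "('d \<Rightarrow> real) \<Rightarrow> int^'d::finite \<Rightarrow> int^'d \<Rightarrow> real" where
  "stencil_weight w j i =
     of_bool (i = j) * (1 + (\<Sum>k\<in>UNIV. \<Sum>\<sigma>\<in>{1::int, -1}. w k)) +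
     (\<Sum>k\<in>UNIV. \<Sum>\<sigma>\<in>{1, -1}. of_bool (i = j + axis k \<sigma>) * (w k + 1))"

definition stencil_total :: "('d::finite \<Rightarrow> real) \<Rightarrow> real" where
  "stencil_total w = 1 + (\<Sum>k\<in>UNIV. \<Sum>\<sigma>\<in>{1::int, -1}. w k) + (\<Sum>k\<in>UNIV. \<Sum>\<sigma>\<in>{1::int, -1}. w k + 1)"

lemma sum_of_bool_eq_le: "finite I \<Longrightarrow> (\<Sum>i\<in>I. of_bool (i = x)) \<le> (1::real)"
  by (simp add: of_bool_def)

text \<open>Each indicator singles out at most one index, whether the row or the column is fixed,
  since \<open>i = j + axis k \<sigma>\<close> can be solved for either. The bound does not depend
  on the grid, as Schur's test requires.\<close>

lemma sum_stencil_weight_le: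
  fixes I :: "(int^'d::finite) set"
  assumes "finite I" and w: "\<And>k. 0 \<le> w k"
  shows "(\<Sum>i\<in>I. stencil_weight w j i) \<le> stencil_total w"
    and "(\<Sum>j\<in>I. stencil_weight w j i) \<le> stencil_total w"
proof -
  have gen: "(\<Sum>i\<in>I. of_bool (P i) * (1 + (\<Sum>k\<in>UNIV. \<Sum>\<sigma>\<in>{1::int, -1}. w k)) +
     (\<Sum>k\<in>UNIV. \<Sum>\<sigma>\<in>{1, -1}. of_bool (Q k \<sigma> i) * (w k + 1))) \<le> stencil_total w"
    if P: "\<And>i. P i \<longleftrightarrow> i = y" and Q: "\<And>k \<sigma> i. Q k \<sigma> i \<longleftrightarrow> i = z k \<sigma>"
    for P :: "int^'d \<Rightarrow> bool" and Q :: "'d \<Rightarrow> int \<Rightarrow> int^'d \<Rightarrow> bool" and y z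
  proof -
    have "(\<Sum>i\<in>I. of_bool (P i) * (1 + (\<Sum>k\<in>UNIV. \<Sum>\<sigma>\<in>{1::int, -1}. w k)) +
       (\<Sum>k\<in>UNIV. \<Sum>\<sigma>\<in>{1, -1}. of_bool (Q k \<sigma> i) * (w k + 1))) =
      (\<Sum>i\<in>I. of_bool (i = y)) * (1 + (\<Sum>k\<in>UNIV. \<Sum>\<sigma>\<in>{1::int, -1}. w k)) +
       (\<Sum>k\<in>UNIV. \<Sum>\<sigma>\<in>{1, -1}. (\<Sum>i\<in>I. of_bool (i = z k \<sigma>)) * (w k + 1))"
      unfolding P Q sum.distrib sum_distrib_right by (simp only: sum.swap[of _ _ I])
    also have "\<dots> \<le> 1 * (1 + (\<Sum>k\<in>UNIV. \<Sum>\<sigma>\<in>{1::int, -1}. w k)) +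
       (\<Sum>k\<in>UNIV. \<Sum>\<sigma>\<in>{1::int, -1}. 1 * (w k + 1))"
      using w by (intro add_mono sum_mono mult_right_mono sum_of_bool_eq_le assms(1) add_nonneg_nonneg sum_nonneg) auto
    finally show ?thesis by (simp add: stencil_total_def)
  qed
  show "(\<Sum>i\<in>I. stencil_weight w j i) \<le> stencil_total w"
    unfolding stencil_weight_def by (rule gen) auto
  have "i = j + axis k \<sigma> \<longleftrightarrow> j = i - axis k \<sigma>" for j k and \<sigma> :: int
    by (auto simp: algebra_simps)
  then show "(\<Sum>j\<in>I. stencil_weight w j i) \<le> stencil_total w"
    unfolding stencil_weight_def by (intro gen) auto
qed

lemma stencil_total_nonneg: "(\<And>k. 0 \<le> w k) \<Longrightarrow> 0 \<le> stencil_total w"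
  unfolding stencil_total_def by (intro add_nonneg_nonneg sum_nonneg) auto

text \<open>Here \<open>A\<close> holds diffusion coefficients at midpoints, \<open>p\<close> their
  model values, and \<open>c\<close> and \<open>B\<close> the scaled lower-order terms. Setting
  \<open>c\<close>, \<open>A\<close> and \<open>B\<close> to zero also covers the rows outside
  \<open>W\<close>.\<close>

lemma stencil_residual:
  fixes i j :: "int^'d::finite" and A B :: "'d \<Rightarrow> int \<Rightarrow> real"
  assumes c: "\<bar>c\<bar> \<le> \<eta>" and w: "\<And>k. 0 \<le> w k"
    and A: "\<And>k \<sigma>. \<sigma> \<in> {1, -1} \<Longrightarrow> \<bar>A k \<sigma> - p k\<bar> \<le> \<eta>" and B: "\<And>k \<sigma>. \<sigma> \<in> {1, -1} \<Longrightarrow> \<bar>B k \<sigma>\<bar> \<le> \<eta>"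
  shows "\<bar>of_bool (i = j) * (c + (\<Sum>k\<in>UNIV. \<Sum>\<sigma>\<in>{1, -1}. A k \<sigma> * w k)) -
      (\<Sum>k\<in>UNIV. \<Sum>\<sigma>\<in>{1, -1}. of_bool (i = j + axis k \<sigma>) * (A k \<sigma> * w k - B k \<sigma>)) -
      (\<Sum>k\<in>UNIV. p k * (w k * (2 * of_bool (i = j) - (\<Sum>\<sigma>\<in>{1, -1}. of_bool (i = j + axis k \<sigma>)))))\<bar>
    \<le> \<eta> * stencil_weight w j i"
    (is "\<bar>?E - ?M\<bar> \<le> _")
proof -
  \<comment> \<open>The factor 2 on the diagonal is written as a sum over the two directions, so
    that the model has the same shape as the first two terms and can be subtracted termwise.\<close>
  have M: "?M = of_bool (i = j) * (\<Sum>k\<in>UNIV. \<Sum>\<sigma>\<in>{1::int, -1}. p k * w k) -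
      (\<Sum>k\<in>UNIV. \<Sum>\<sigma>\<in>{1, -1}. of_bool (i = j + axis k \<sigma>) * (p k * w k))"
    unfolding sum_distrib_left sum_subtractf[symmetric]
    by (intro sum.cong refl) (simp add: algebra_simps)
  have Aw: "\<bar>(A k \<sigma> - p k) * w k\<bar> \<le> \<eta> * w k" if "\<sigma> \<in> {1, -1}" for k \<sigma>
    using A[OF that, of k] w[of k] by (simp add: abs_mult mult_right_mono)
  have "?E - ?M = of_bool (i = j) * (c + (\<Sum>k\<in>UNIV. \<Sum>\<sigma>\<in>{1, -1}. (A k \<sigma> - p k) * w k)) -
      (\<Sum>k\<in>UNIV. \<Sum>\<sigma>\<in>{1, -1}. of_bool (i = j + axis k \<sigma>) * ((A k \<sigma> - p k) * w k - B k \<sigma>))"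
    unfolding M by (simp only: left_diff_distrib right_diff_distrib sum_subtractf distrib_left)
  also have "\<bar>\<dots>\<bar> \<le> of_bool (i = j) * (\<eta> + (\<Sum>k\<in>UNIV. \<Sum>\<sigma>\<in>{1::int, -1}. \<eta> * w k)) +
      (\<Sum>k\<in>UNIV. \<Sum>\<sigma>\<in>{1, -1}. of_bool (i = j + axis k \<sigma>) * (\<eta> * w k + \<eta>))"
  proof (rule order_trans[OF abs_triangle_ineq4], rule add_mono)
    have "\<bar>c + (\<Sum>k\<in>UNIV. \<Sum>\<sigma>\<in>{1, -1}. (A k \<sigma> - p k) * w k)\<bar> \<le> \<eta> + (\<Sum>k\<in>UNIV. \<Sum>\<sigma>\<in>{1::int, -1}. \<eta> * w k)"
      by (intro order_trans[OF abs_triangle_ineq] add_mono c order_trans[OF sum_abs] sum_mono Aw)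
    then show "\<bar>of_bool (i = j) * (c + (\<Sum>k\<in>UNIV. \<Sum>\<sigma>\<in>{1, -1}. (A k \<sigma> - p k) * w k))\<bar>
      \<le> of_bool (i = j) * (\<eta> + (\<Sum>k\<in>UNIV. \<Sum>\<sigma>\<in>{1::int, -1}. \<eta> * w k))"
      by (simp add: abs_mult)
    have "\<bar>of_bool (i = j + axis k \<sigma>) * ((A k \<sigma> - p k) * w k - B k \<sigma>)\<bar>
      \<le> of_bool (i = j + axis k \<sigma>) * (\<eta> * w k + \<eta>)" if "\<sigma> \<in> {1, -1}" for k \<sigma>
    proof -
      have "\<bar>(A k \<sigma> - p k) * w k - B k \<sigma>\<bar> \<le> \<eta> * w k + \<eta>"
        using Aw[OF that, of k] B[OF that, of k] by linarith
      then show ?thesis by simp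
    qed
    then show "\<bar>\<Sum>k\<in>UNIV. \<Sum>\<sigma>\<in>{1, -1}. of_bool (i = j + axis k \<sigma>) * ((A k \<sigma> - p k) * w k - B k \<sigma>)\<bar>
      \<le> (\<Sum>k\<in>UNIV. \<Sum>\<sigma>\<in>{1, -1}. of_bool (i = j + axis k \<sigma>) * (\<eta> * w k + \<eta>))"
      by (intro order_trans[OF sum_abs] sum_mono) 
  qed
  also have "\<dots> = \<eta> * stencil_weight w j i"
    unfolding stencil_weight_def distrib_left sum_distrib_left
    by (simp only: mult.left_commute[of \<eta>] mult.commute[of \<eta> "of_bool _"] distrib_left mult_1_right sum_distrib_left)
  finally show ?thesis .
qed


section \<open>Uniform continuity, admissible indices and the geometry of fine grids\<close>

lemma uniformly_continuous_family:
  fixes f :: "'d::finite \<Rightarrow> 'a::metric_space \<Rightarrow> real"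
  assumes "compact S" "\<And>k. continuous_on S (f k)" "0 < \<epsilon>"
  obtains d where "0 < d" "\<And>k x y. x \<in> S \<Longrightarrow> y \<in> S \<Longrightarrow> dist x y < d \<Longrightarrow> \<bar>f k x - f k y\<bar> < \<epsilon>"
proof -
  have "\<exists>d>0. \<forall>x\<in>S. \<forall>y\<in>S. dist x y < d \<longrightarrow> \<bar>f k x - f k y\<bar> < \<epsilon>" for k
    using compact_uniformly_continuous[OF assms(2,1), of k] assms(3)
    unfolding uniformly_continuous_on_def by (auto simp: dist_real_def dist_commute abs_minus_commute)
  then obtain d where d: "\<And>k. 0 < d k" "\<And>k x y. x \<in> S \<Longrightarrow> y \<in> S \<Longrightarrow> dist x y < d k \<Longrightarrow> \<bar>f k x - f k y\<bar> < \<epsilon>"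
    by metis
  show thesis
  proof (rule that[of "Min (range d)"])
    show "0 < Min (range d)" using d(1) by (simp add: Min_gr_iff)
    show "\<bar>f k x - f k y\<bar> < \<epsilon>" if "x \<in> S" "y \<in> S" "dist x y < Min (range d)" for k x y
      using that Min_le[of "range d" "d k"] by (intro d(2)) auto
  qed
qed

lemma dist_less_if_components:
  fixes x y :: "real^'d::finite"
  assumes "\<And>k. \<bar>x $ k - y $ k\<bar> < e / CARD('d)"
  shows "dist x y < e"
proof -
  have "dist x y \<le> (\<Sum>k\<in>UNIV. \<bar>(x - y) $ k\<bar>)"
    unfolding dist_norm by (rule norm_le_l1_cart)
  also have "\<dots> < (\<Sum>k\<in>(UNIV::'d set). e / CARD('d))"
    using assms by (intro sum_strict_mono) auto
  finally show ?thesis by simp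
qed

text \<open>For admissible \<open>n\<close> the product with each component of \<open>\<nu>\<close>
  is already an integer, so the floor in \<open>mindex\<close> changes nothing.\<close>

lemma mindex_plus_1:
  assumes "n \<in> admissible \<nu>"
  shows "real_of_int (mindex \<nu> n $ k) + 1 = real n * \<nu> $ k"
proof -
  have "real n * \<nu> $ k \<in> \<int>" using assms by (simp add: admissible_def)
  then obtain z where "real n * \<nu> $ k = of_int z" by (rule Ints_cases)
  then show ?thesis by (simp add: mindex_def)
qed

lemma multi_index_mindex:
  assumes "n \<in> admissible \<nu>" "\<And>k. 0 < \<nu> $ k"
  shows "multi_index (mindex \<nu> n)"
proof
  fix k
  have "0 < real n * \<nu> $ k" using assms by (simp add: admissible_def)
  then have "0 < real_of_int (mindex \<nu> n $ k + 1)"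
    using mindex_plus_1[OF assms(1), of k] by simp
  then show "0 \<le> mindex \<nu> n $ k" by linarith
qed

lemma step_mindex: "n \<in> admissible \<nu> \<Longrightarrow> step (mindex \<nu> n) k = 1 / (real n * \<nu> $ k)"
  by (simp add: step_def mindex_plus_1)

lemma eventually_step_less:
  fixes \<nu> :: "real^'d::finite"
  assumes "\<And>k. 0 < \<nu> $ k" "0 < e"
  shows "\<forall>\<^sub>F n in sequentially. n \<in> admissible \<nu> \<longrightarrow> (\<forall>k. step (mindex \<nu> n) k < e)"
proof -
  have "\<forall>\<^sub>F n in sequentially. (1 / \<nu> $ k) / real n < e" for k
    using order_tendstoD(2)[OF lim_const_over_n assms(2)] .
  then have "\<forall>\<^sub>F n in sequentially. \<forall>k. (1 / \<nu> $ k) / real n < e"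
    by (rule eventually_all_finite)
  then show ?thesis
    by eventually_elim (simp add: step_mindex mult.commute)
qed

lemma grid_pt_add: "grid_pt n (rvec j + t *\<^sub>R axis k 1) = grid_pt n (rvec j) + (t * step n k) *\<^sub>R axis k 1"
  by (auto simp: grid_pt_def Finite_Cartesian_Product.vec_eq_iff axis_def algebra_simps)

text \<open>The GLT diagonal samples at \<open>j / n\<close>, the difference scheme at
  \<open>j / (n + 1)\<close>. The coordinates differ by \<open>j / n\<close> times the step, where
  \<open>j / n\<close> is at most 1.\<close>

lemma dist_sampling_pt_grid_pt_le:
  fixes n j :: "int^'d::finite"
  assumes "j \<in> {1..n}" 
  shows "(\<chi> k. of_int (j $ k) / of_int (n $ k)) \<in> cbox 0 (1 :: real^'d)"
    and "grid_pt n (rvec j) \<in> cbox 0 (1 :: real^'d)"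
    and "\<bar>(\<chi> k. of_int (j $ k) / of_int (n $ k)) $ k - grid_pt n (rvec j) $ k\<bar> \<le> step n k"
proof -
  have j: "1 \<le> j $ k" "j $ k \<le> n $ k" "0 < n $ k" for k
  proof -
    show "1 \<le> j $ k" "j $ k \<le> n $ k" using assms by (auto simp: Finite_Cartesian_Product.less_eq_vec_def)
    then show "0 < n $ k" by linarith
  qed
  show "(\<chi> k. of_int (j $ k) / of_int (n $ k)) \<in> cbox 0 (1 :: real^'d)"
    using j less_imp_le[OF j(3)] order_trans[OF zero_le_one j(1)] by (simp add: mem_box_cart divide_le_eq_1)
  have pos: "0 < real_of_int (n $ k)" "0 < real_of_int (n $ k) + 1" "0 \<le> real_of_int (j $ k)" "real_of_int (j $ k) \<le> real_of_int (n $ k)"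
      "real_of_int (j $ k) \<le> real_of_int (n $ k) + 1" for k
    using j[of k] by linarith+
  show "grid_pt n (rvec j) \<in> cbox 0 (1 :: real^'d)"
    using pos by (simp add: mem_box_cart grid_pt_def step_def rvec_def divide_le_eq_1_pos less_imp_le)
  have "real_of_int (j $ k) / of_int (n $ k) - of_int (j $ k) / (of_int (n $ k) + 1) =
     (of_int (j $ k) / of_int (n $ k)) * (1 / (of_int (n $ k) + 1))"
    using pos(1,2)[of k] by (simp add: field_simps)
  moreover have "0 \<le> real_of_int (j $ k) / of_int (n $ k)" "real_of_int (j $ k) / of_int (n $ k) \<le> 1"
    using pos(1,3,4)[of k] by (simp_all add: divide_le_eq_1)
  moreover have "0 \<le> 1 / (real_of_int (n $ k) + 1)" using pos(2)[of k] by simp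
  ultimately have "0 \<le> real_of_int (j $ k) / of_int (n $ k) - of_int (j $ k) / (of_int (n $ k) + 1)"
    "real_of_int (j $ k) / of_int (n $ k) - of_int (j $ k) / (of_int (n $ k) + 1) \<le> 1 / (of_int (n $ k) + 1)"
    by (simp_all only: mult_nonneg_nonneg mult_left_le_one_le)
  then show "\<bar>(\<chi> k. of_int (j $ k) / of_int (n $ k)) $ k - grid_pt n (rvec j) $ k\<bar> \<le> step n k"
    by (simp add: grid_pt_def step_def rvec_def)
qed

lemma infdist_Compl_ge_imp_ball_subset:
  assumes "\<delta> \<le> infdist x (- W)"
  shows "ball x \<delta> \<subseteq> W"
proof
  fix y assume "y \<in> ball x \<delta>"
  then show "y \<in> W"
    using assms infdist_le[of y "- W" x] by force
qed

text \<open>A set inside the open cube contains no grid point with a coordinate index 0 or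
  \<open>n $ k + 1\<close>; this reconciles the index range of the scheme with that of the GLT
  matrices.\<close>

lemma sw_index_eq:
  fixes n :: "int^'d::finite"
  assumes nonneg: "\<And>k. 0 \<le> n $ k" and W: "W \<subseteq> box 0 1"
  shows "sw_index W n = {j \<in> {1..n}. grid_pt n (rvec j) \<in> W}"
proof -
  have "1 \<le> j $ k \<and> j $ k \<le> n $ k" if "grid_pt n (rvec j) \<in> W" for j k
  proof -
    have pos: "0 < real_of_int (n $ k) + 1" using nonneg[of k] by (simp add: add_nonneg_pos)
    have "grid_pt n (rvec j) \<in> box 0 1" using that W by blast
    then have "0 < of_int (j $ k) * step n k" "of_int (j $ k) * step n k < 1"
      by (simp_all add: mem_box_cart grid_pt_def rvec_def)
    then have "0 < real_of_int (j $ k)" "real_of_int (j $ k) < of_int (n $ k) + 1"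
      using pos by (simp_all add: step_def zero_less_divide_iff)
    then show ?thesis by linarith
  qed
  then have "0 \<le> j \<and> j \<le> n + 1 \<and> 1 \<le> j \<and> j \<le> n" if "grid_pt n (rvec j) \<in> W" for j
    using that by (auto simp: Finite_Cartesian_Product.less_eq_vec_def intro: order_trans[OF zero_le_one] add_increasing2)
  then show ?thesis by (auto simp: sw_index_def)
qed


section \<open>Approximation of the Shortley--Weller matrix\<close>

lemma bounded_family:
  fixes f :: "'d::finite \<Rightarrow> 'a::topological_space \<Rightarrow> real"
  assumes "compact S" "\<And>k. continuous_on S (f k)"
  obtains M where "\<And>k x. x \<in> S \<Longrightarrow> \<bar>f k x\<bar> \<le> M"
proof -
  have "bounded (f k ` S)" for k
    by (intro compact_imp_bounded compact_continuous_image assms)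
  then have "\<exists>M. \<forall>x\<in>S. \<bar>f k x\<bar> \<le> M" for k
    by (auto simp: bounded_iff)
  then obtain M where M: "\<And>k x. x \<in> S \<Longrightarrow> \<bar>f k x\<bar> \<le> M k" by metis
  show thesis
  proof (rule that)
    show "\<bar>f k x\<bar> \<le> Max (range M)" if "x \<in> S" for k x
      using M[OF that, of k] by (rule order_trans) simp
  qed
qed

text \<open>The indicators of the exceptional sets tend to 0 pointwise and are dominated by 1, which
  is integrable because the measure is finite.\<close>

lemma tendsto_in_measure_pointwise:
  assumes fin: "emeasure M (space M) < \<infinity>"
    and meas [measurable]: "\<And>m. g m \<in> borel_measurable M" "h \<in> borel_measurable M"
    and lim: "\<And>x. x \<in> space M \<Longrightarrow> (\<lambda>m. g m x) \<longlonglongrightarrow> h x"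
  shows "tendsto_in_measure M g h"
  unfolding tendsto_in_measure_def
proof (intro allI impI)
  fix \<epsilon> :: real assume "0 < \<epsilon>"
  define E where "E = (\<lambda>m. {x \<in> space M. cmod (g m x - h x) > \<epsilon>})"
  have [measurable]: "E m \<in> sets M" for m unfolding E_def by measurable
  have "(\<lambda>m. \<integral>\<^sup>+x. indicator (E m) x \<partial>M) \<longlonglongrightarrow> (\<integral>\<^sup>+x. 0 \<partial>M)"
  proof (rule nn_integral_dominated_convergence[where w = "\<lambda>_. 1"])
    show "AE x in M. (\<lambda>m. indicator (E m) x :: ennreal) \<longlonglongrightarrow> 0"
    proof (rule AE_I2)
      fix x assume "x \<in> space M"
      from tendstoD[OF lim[OF this] \<open>0 < \<epsilon>\<close>]
      have "\<forall>\<^sub>F m in sequentially. indicator (E m) x = (0 :: ennreal)"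
        by eventually_elim (auto simp: E_def dist_norm)
      then show "(\<lambda>m. indicator (E m) x :: ennreal) \<longlonglongrightarrow> 0" by (rule tendsto_eventually)
    qed
  qed (use fin in \<open>auto simp: indicator_def\<close>)
  then have "(\<lambda>m. emeasure M (E m)) \<longlonglongrightarrow> 0" by simp
  then show "(\<lambda>m. emeasure M {x \<in> space M. cmod (g m x - h x) > \<epsilon>}) \<longlonglongrightarrow> 0"
    unfolding E_def .
qed

section \<open>Entrywise comparison with the model and the count of rows near the boundary\<close>

locale shortley_weller =
  fixes \<Omega> :: "(real^'d::{finite,linorder}) set"
    and a b :: "'d \<Rightarrow> real^'d::{finite,linorder} \<Rightarrow> real"
    and c :: "real^'d::{finite,linorder} \<Rightarrow> real"
    and \<nu> :: "real^'d::{finite,linorder}"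
  assumes closed: "closed \<Omega>" and subset_cube: "\<Omega> \<subseteq> cbox 0 1"
    and cont_a: "\<And>k. continuous_on \<Omega> (a k)"
    and cont_b: "\<And>k. continuous_on \<Omega> (b k)"
    and cont_c: "continuous_on \<Omega> c"
    and \<nu>_pos: "\<And>k. 0 < \<nu> $ k"
begin

abbreviation W where "W \<equiv> interior \<Omega>"

definition extended_entry :: "nat \<Rightarrow> int^'d::{finite,linorder} \<Rightarrow> int^'d::{finite,linorder} \<Rightarrow> real" where
  "extended_entry n j i =
    (if grid_pt (mindex \<nu> n) (rvec j) \<in> W \<and> grid_pt (mindex \<nu> n) (rvec i) \<in> W
     then sw_entry a b c W (mindex \<nu> n) j i * (1 / (real n)\<^sup>2) else 0)"

text \<open>The entries of the sum over \<open>k\<close> of \<open>D(p\<^sub>k) T(\<nu>\<^sub>k\<^sup>2 (2 - 2 cos \<theta>\<^sub>k))\<close>.\<close>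

definition model_entry :: "('d \<Rightarrow> real^'d::{finite,linorder} \<Rightarrow> real) \<Rightarrow> nat \<Rightarrow> int^'d::{finite,linorder} \<Rightarrow> int^'d::{finite,linorder} \<Rightarrow> real" where
  "model_entry p n j i =
    (\<Sum>k\<in>UNIV. p k (\<chi> k. of_int (j $ k) / of_int (mindex \<nu> n $ k)) *
      ((\<nu> $ k)\<^sup>2 * (2 * of_bool (i = j) - (\<Sum>\<sigma>\<in>{1, -1}. of_bool (i = j + axis k \<sigma>)))))"

lemma compact: "compact \<Omega>"
  using closed subset_cube bounded_subset[OF bounded_cbox] by (auto simp: compact_eq_bounded_closed)

lemma W_subset: "W \<subseteq> \<Omega>" "W \<subseteq> box 0 1"
  using interior_subset interior_mono[OF subset_cube] by (auto simp: interior_cbox)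

text \<open>Nonemptiness matters because \<open>infdist\<close> to the empty set is 0 by convention,
  so vanishing distance would not express membership.\<close>

lemma Compl_W: "closed (- W)" "- W \<noteq> {}"
proof -
  have "bounded W" using bounded_subset[OF compact_imp_bounded[OF compact] W_subset(1)] .
  then show "- W \<noteq> {}" using not_bounded_UNIV by (metis Compl_UNIV_eq double_compl)
qed auto

lemma nonneg_mindex: "n \<in> admissible \<nu> \<Longrightarrow> 0 \<le> mindex \<nu> n $ k"
  using multi_index.nonneg[OF multi_index_mindex[OF _ \<nu>_pos]] .

lemma scaled_sw_matrix_eq_restr_mat:
  assumes "n \<in> admissible \<nu>"
  shows "complex_of_real (1 / (real n)\<^sup>2) \<cdot>\<^sub>m sw_matrix a b c W (mindex \<nu> n) =
    restr_mat W (mindex \<nu> n) (multilevel_mat (mindex \<nu> n) (\<lambda>j i. complex_of_real (extended_entry n j i)))"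
proof -
  interpret multi_index "mindex \<nu> n" by (rule multi_index_mindex[OF assms \<nu>_pos])
  define S where "S = {j \<in> {1..mindex \<nu> n}. grid_pt (mindex \<nu> n) (rvec j) \<in> W}"
  have S: "sw_index W (mindex \<nu> n) = S"
    unfolding S_def by (rule sw_index_eq[OF nonneg W_subset(2)])
  have "finite S" 
    by (rule finite_subset[OF _ finite_multi_index[of 1 "mindex \<nu> n"]]) (auto simp: S_def)
  then have "lex_list S ! p \<in> S" if "p < length (lex_list S)" for p
    using that nth_mem lex_list(2) by blast
  then show ?thesis
    unfolding restr_multilevel_mat sw_matrix_def Let_def S S_def[symmetric]
    by (intro eq_matI) (auto simp: extended_entry_def S_def)
qed

text \<open>The three \<open>\<eta>\<close> for a row in \<open>W\<close> come from moving half a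
  step to the midpoint, moving between the grid point and the sampling point, and replacing the
  cut-off coefficient by \<open>p\<close>.\<close>

lemma eventually_entry_close:
  assumes \<delta>: "0 < \<delta>" and \<eta>: "0 < \<eta>"
    and extends: "\<And>k. continuous_on UNIV (a' k)" "\<And>k. \<forall>x\<in>\<Omega>. a' k x = a k x"
    and p: "\<And>k. \<forall>x\<in>cbox 0 1. \<bar>a' k x * min 1 (infdist x (- W) / \<delta>) - p k x\<bar> < \<eta>"
  shows "\<forall>\<^sub>F n in sequentially. n \<in> admissible \<nu> \<longrightarrow> (\<forall>j\<in>{1..mindex \<nu> n}. \<forall>i\<in>{1..mindex \<nu> n}.
    (grid_pt (mindex \<nu> n) (rvec j) \<in> W \<longrightarrow> \<delta> \<le> infdist (grid_pt (mindex \<nu> n) (rvec j)) (- W)) \<longrightarrow>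
    \<bar>extended_entry n j i - model_entry p n j i\<bar> \<le> 3 * \<eta> * stencil_weight (\<lambda>k. (\<nu> $ k)\<^sup>2) j i)"
proof -
  \<comment> \<open>Multiplying by this cut-off instead of the indicator of \<open>W\<close> keeps
    the coefficient continuous, hence uniformly continuous on the cube.\<close>
  define g where "g = (\<lambda>k x. a' k x * min 1 (infdist x (- W) / \<delta>))"
  have cont: "continuous_on (cbox 0 1) (a' k)" "continuous_on (cbox 0 1) (g k)" for k
  proof -
    show a': "continuous_on (cbox 0 1) (a' k)" by (rule continuous_on_subset[OF extends(1)]) simp
    show "continuous_on (cbox 0 1) (g k)"
      unfolding g_def using \<delta> by (intro continuous_intros a') auto
  qed
  obtain d1 where d1: "0 < d1" "\<And>k x y. x \<in> cbox 0 1 \<Longrightarrow> y \<in> cbox 0 1 \<Longrightarrow> dist x y < d1 \<Longrightarrow> \<bar>a' k x - a' k y\<bar> < \<eta>"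
    using uniformly_continuous_family[where f = a', OF compact_cbox cont(1) \<eta>] by blast
  obtain d2 where d2: "0 < d2" "\<And>k x y. x \<in> cbox 0 1 \<Longrightarrow> y \<in> cbox 0 1 \<Longrightarrow> dist x y < d2 \<Longrightarrow> \<bar>g k x - g k y\<bar> < \<eta>"
    using uniformly_continuous_family[where f = g, OF compact_cbox cont(2) \<eta>] by blast
  obtain M1 where M1: "\<And>k x. x \<in> \<Omega> \<Longrightarrow> \<bar>b k x\<bar> \<le> M1"
    using bounded_family[where f = b, OF compact cont_b] by blast
  obtain M2 where M2: "\<And>x. x \<in> \<Omega> \<Longrightarrow> \<bar>c x\<bar> \<le> M2"
    using compact_imp_bounded[OF compact_continuous_image[OF cont_c compact]]
    unfolding bounded_iff by (metis imageI real_norm_def)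
  have "\<forall>\<^sub>F n in sequentially. \<forall>k. M1 * \<nu> $ k / real n < \<eta>"
    by (intro eventually_all_finite order_tendstoD(2)[OF lim_const_over_n \<eta>])
  moreover have "\<forall>\<^sub>F n in sequentially. M2 / real n < \<eta>"
    by (rule order_tendstoD(2)[OF lim_const_over_n \<eta>])
  moreover have "0 < min (min d1 d2) \<delta> / CARD('d)" using d1 d2 \<delta> by simp
  from eventually_step_less[OF \<nu>_pos this]
  have "\<forall>\<^sub>F n in sequentially. n \<in> admissible \<nu> \<longrightarrow> (\<forall>k. step (mindex \<nu> n) k < min (min d1 d2) \<delta> / CARD('d))" .
  ultimately show ?thesis
  proof eventually_elim
    case (elim n)
    show ?case
    proof (intro impI ballI)
      fix j i assume n: "n \<in> admissible \<nu>" and j: "j \<in> {1..mindex \<nu> n}"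
        and good: "grid_pt (mindex \<nu> n) (rvec j) \<in> W \<longrightarrow> \<delta> \<le> infdist (grid_pt (mindex \<nu> n) (rvec j)) (- W)"
      define x where "x = grid_pt (mindex \<nu> n) (rvec j)"
      define y :: "real^'d::{finite,linorder}" where "y = (\<chi> k. of_int (j $ k) / of_int (mindex \<nu> n $ k))"
      define h where "h = step (mindex \<nu> n)"
      define r where "r = 1 / (real n)\<^sup>2"
      have n_pos: "0 < real n" "1 \<le> real n" using n by (auto simp: admissible_def)
      have h: "h k = 1 / (real n * \<nu> $ k)" for k unfolding h_def by (rule step_mindex[OF n])
      have h_pos: "0 < h k" for k using n_pos \<nu>_pos by (simp add: h)
      have h_less: "h k < min (min d1 d2) \<delta> / CARD('d)" for k using elim(3) n by (simp add: h_def)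
      have "min (min d1 d2) \<delta> / CARD('d) \<le> min (min d1 d2) \<delta> / 1"
        using d1(1) d2(1) \<delta> by (intro divide_left_mono) (auto simp: Suc_leI)
      then have h_less': "h k < min (min d1 d2) \<delta>" for k
        using less_le_trans[OF h_less[of k]] by (simp only: div_by_1)
      have xy: "x \<in> cbox 0 1" "y \<in> cbox 0 1"
        unfolding x_def y_def using dist_sampling_pt_grid_pt_le[OF j] by auto
      have "dist y x < min (min d1 d2) \<delta>"
        unfolding x_def y_def
        by (intro dist_less_if_components le_less_trans[OF dist_sampling_pt_grid_pt_le(3)[OF j] h_less[unfolded h_def]])
      then have gxy: "\<bar>g k y - g k x\<bar> < \<eta>" for k using d2(2)[OF xy(2,1)] by simp
      have py: "\<bar>g k y - p k y\<bar> < \<eta>" for k unfolding g_def by (rule bspec[OF p xy(2)])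
      have model: "model_entry p n j i = (\<Sum>k\<in>UNIV. p k y * ((\<nu> $ k)\<^sup>2 * (2 * of_bool (i = j) -
          (\<Sum>\<sigma>\<in>{1, -1}. of_bool (i = j + axis k \<sigma>)))))"
        by (simp add: model_entry_def y_def)
      show "\<bar>extended_entry n j i - model_entry p n j i\<bar> \<le> 3 * \<eta> * stencil_weight (\<lambda>k. (\<nu> $ k)\<^sup>2) j i"
      proof (cases "x \<in> W")
        case False
        \<comment> \<open>Off \<open>W\<close> the cut-off vanishes, so \<open>p\<close> is small at
          the nearby sampling point, while the extended entry is exactly 0.\<close>
        then have "g k x = 0" for k by (simp add: g_def)
        then have "\<bar>p k y\<bar> \<le> 3 * \<eta>" for k using gxy[of k] py[of k] by (simp only:)
        then have "\<bar>0 - p k y\<bar> \<le> 3 * \<eta>" for k by simp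
        from stencil_residual[of 0 "3 * \<eta>" "\<lambda>k. (\<nu> $ k)\<^sup>2" "\<lambda>_ _. 0" "\<lambda>k. p k y" "\<lambda>_ _. 0" i j, OF _ _ this]
        show ?thesis using False \<eta> by (simp add: model extended_entry_def x_def[symmetric])
      next
        case True
        then have dx: "\<delta> \<le> infdist x (- W)" using good by (simp add: x_def)
        then have ball: "ball x \<delta> \<subseteq> W" by (rule infdist_Compl_ge_imp_ball_subset)
        have s: "sw_s W (mindex \<nu> n) j k \<sigma> = 1" if "\<sigma> \<in> {1, -1}" for k \<sigma>
          using ball h_pos[of k] h_less'[of k] that unfolding x_def h_def by (intro sw_s_eq_1) auto
        have shift: "dist x (x + (t * h k) *\<^sub>R axis k 1) < min (min d1 d2) \<delta>" if "\<bar>t\<bar> \<le> 1" for t k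
        proof -
          have "dist x (x + (t * h k) *\<^sub>R axis k 1) = \<bar>t\<bar> * h k"
            using h_pos[of k] by (simp add: dist_norm norm_axis_1 abs_mult)
          also have "\<dots> \<le> 1 * h k" using that h_pos[of k] by (intro mult_right_mono) auto
          also have "\<dots> < min (min d1 d2) \<delta>" using h_less'[of k] by (simp only: mult_1)
          finally show ?thesis .
        qed
        define A where "A = (\<lambda>k \<sigma>. a k (grid_pt (mindex \<nu> n) (rvec j + (of_int \<sigma> / 2) *\<^sub>R axis k 1)))"
        define B where "B = (\<lambda>k \<sigma>. of_int \<sigma> * b k x / (2 * h k) * r)"
        \<comment> \<open>The step is \<open>1 / (n * \<nu> $ k)\<close>, so the scaling by
          \<open>r\<close> cancels every power of \<open>n\<close>; this is where the squared
          weights of the symbol originate.\<close>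
        have hr: "z / (h k)\<^sup>2 * r = z * (\<nu> $ k)\<^sup>2" for z k
          using n_pos by (simp add: h r_def power_divide power_mult_distrib)
        have full: "sw_entry a b c W (mindex \<nu> n) j i =
            of_bool (i = j) * (c x + (\<Sum>k\<in>UNIV. \<Sum>\<sigma>\<in>{1, -1}. A k \<sigma> / (h k)\<^sup>2)) -
            (\<Sum>k\<in>UNIV. \<Sum>\<sigma>\<in>{1, -1}. of_bool (i = j + axis k \<sigma>) *
              (A k \<sigma> / (h k)\<^sup>2 - of_int \<sigma> * b k x / (2 * h k)))"
          unfolding A_def x_def h_def by (rule sw_entry_full_step) (rule s)
        have entry: "sw_entry a b c W (mindex \<nu> n) j i * r =
            of_bool (i = j) * (c x * r + (\<Sum>k\<in>UNIV. \<Sum>\<sigma>\<in>{1, -1}. A k \<sigma> * (\<nu> $ k)\<^sup>2)) -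
            (\<Sum>k\<in>UNIV. \<Sum>\<sigma>\<in>{1, -1}. of_bool (i = j + axis k \<sigma>) * (A k \<sigma> * (\<nu> $ k)\<^sup>2 - B k \<sigma>))"
          unfolding full B_def
          by (simp only: left_diff_distrib distrib_right sum_distrib_right mult.assoc hr)
        \<comment> \<open>Setting columns outside \<open>W\<close> to zero loses nothing in this
          row: \<open>j\<close> and all its neighbours lie in the ball contained in
          \<open>W\<close>.\<close>
        have ext_entry: "extended_entry n j i = sw_entry a b c W (mindex \<nu> n) j i * r"
        proof (cases "grid_pt (mindex \<nu> n) (rvec i) \<in> W")
          case True
          then show ?thesis using \<open>x \<in> W\<close> by (simp add: extended_entry_def x_def r_def)
        next
          case False
          have "i \<noteq> j" using False \<open>x \<in> W\<close> by (auto simp: x_def)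
          moreover have "i \<noteq> j + axis k \<sigma>" if "\<sigma> \<in> {1, -1}" for k \<sigma>
          proof
            assume i: "i = j + axis k \<sigma>"
            have "rvec i = rvec j + of_int \<sigma> *\<^sub>R axis k 1"
              unfolding i by (simp add: rvec_def Finite_Cartesian_Product.vec_eq_iff axis_def)
            then have "grid_pt (mindex \<nu> n) (rvec i) = x + (of_int \<sigma> * h k) *\<^sub>R axis k 1"
              by (simp add: grid_pt_add x_def h_def)
            moreover have "\<bar>real_of_int \<sigma>\<bar> \<le> 1" using that by auto
            from shift[OF this, of k] have "x + (of_int \<sigma> * h k) *\<^sub>R axis k 1 \<in> W"
              by (intro subsetD[OF ball]) (simp only: mem_ball min_less_iff_conj)
            ultimately show False using False by metis
          qed
          ultimately show ?thesis using False
            unfolding entry by (simp add: extended_entry_def)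
        qed
        have x\<Omega>: "x \<in> \<Omega>" using True W_subset by blast
        have "\<bar>c x * r\<bar> \<le> M2 / real n"
        proof -
          have "r \<le> 1 / real n"
            using n_pos by (simp add: r_def power2_eq_square field_simps)
          then have "\<bar>c x\<bar> * r \<le> M2 * (1 / real n)"
            using M2[OF x\<Omega>] by (intro mult_mono) (auto simp: r_def intro: order_trans[OF abs_ge_zero])
          then show ?thesis by (simp add: abs_mult r_def)
        qed
        then have c_le: "\<bar>c x * r\<bar> \<le> 3 * \<eta>" using elim(2) \<eta> by linarith
        have B_le: "\<bar>B k \<sigma>\<bar> \<le> 3 * \<eta>" if "\<sigma> \<in> {1, -1}" for k \<sigma>
        proof -
          have "\<bar>B k \<sigma>\<bar> = \<bar>b k x\<bar> * (\<nu> $ k / real n) / 2"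
            using n_pos \<nu>_pos[of k] that by (auto simp: B_def h r_def abs_mult power2_eq_square)
          also have "\<dots> \<le> M1 * (\<nu> $ k / real n) / 2"
            using M1[OF x\<Omega>, of k] n_pos less_imp_le[OF \<nu>_pos[of k]] by (intro divide_right_mono mult_right_mono) auto
          also have "\<dots> \<le> \<eta>"
            using elim(1)[rule_format, of k] \<eta> by simp
          finally show ?thesis using \<eta> by linarith
        qed
        \<comment> \<open>The midpoint \<open>z\<close> stays in \<open>W\<close>, where
          \<open>a'\<close> agrees with \<open>a\<close>, and the cut-off equals 1 at
          \<open>x\<close>; the three errors then add up along \<open>z\<close>, \<open>x\<close>,
          \<open>y\<close>.\<close>
        have A_le: "\<bar>A k \<sigma> - p k y\<bar> \<le> 3 * \<eta>" if "\<sigma> \<in> {1, -1}" for k \<sigma>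
        proof -
          define z where "z = x + (of_int \<sigma> / 2 * h k) *\<^sub>R axis k 1"
          have xz: "dist x z < min (min d1 d2) \<delta>"
            unfolding z_def using that by (intro shift) auto
          then have "z \<in> W" using ball by auto
          then have "z \<in> \<Omega>" "z \<in> cbox 0 1" using W_subset subset_cube by auto
          then have "A k \<sigma> = a' k z"
            by (simp add: A_def grid_pt_add x_def[symmetric] h_def[symmetric] z_def extends(2))
          moreover have "\<bar>a' k x - a' k z\<bar> < \<eta>"
            using xz xy(1) \<open>z \<in> cbox 0 1\<close> by (intro d1(2)) auto
          moreover have "g k x = a' k x"
            using dx \<delta> by (simp add: g_def min_def)
          ultimately show ?thesis using gxy[of k] py[of k] by linarith
        qed
        show ?thesis
          unfolding ext_entry entry model by (rule stencil_residual[OF c_le _ A_le B_le]) auto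
      qed
    qed
  qed
qed

text \<open>A bad point is within \<open>\<delta>\<close> of the frontier, and the ball used for
  volume counting has radius \<open>\<delta>\<close> again, so the \<open>2 * \<delta>\<close>
  neighbourhood contains it.\<close>

lemma eventually_card_bad_le:
  assumes \<delta>: "0 < \<delta>" and ne: "frontier \<Omega> \<noteq> {}"
  shows "\<forall>\<^sub>F n in sequentially. n \<in> admissible \<nu> \<longrightarrow>
    real (card {j \<in> {1..mindex \<nu> n}. grid_pt (mindex \<nu> n) (rvec j) \<in> W \<and>
      infdist (grid_pt (mindex \<nu> n) (rvec j)) (- W) < \<delta>})
    \<le> 2 ^ CARD('d) * measure lebesgue {x. infdist x (frontier \<Omega>) \<le> 2 * \<delta>} * msize (mindex \<nu> n)"
proof -
  have "0 < \<delta> / CARD('d)" using \<delta> by simp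
  from eventually_step_less[OF \<nu>_pos this] show ?thesis
  proof eventually_elim
    case (elim n)
    show ?case
    proof (intro impI card_grid_le_msize[where e = \<delta>])
      assume n: "n \<in> admissible \<nu>"
      show "0 \<le> mindex \<nu> n $ k" for k using n by (rule nonneg_mindex)
      show "step (mindex \<nu> n) k \<le> \<delta> / CARD('d)" for k using elim n by (simp add: less_imp_le)
      show "{x. infdist x (frontier \<Omega>) \<le> 2 * \<delta>} \<in> lmeasurable"
        using \<delta> by (intro lmeasurable_compact compact_infdist_le ne compact_frontier compact) auto
      show "cball (grid_pt (mindex \<nu> n) (rvec j)) \<delta> \<subseteq> {x. infdist x (frontier \<Omega>) \<le> 2 * \<delta>}"
        if "j \<in> {j \<in> {1..mindex \<nu> n}. grid_pt (mindex \<nu> n) (rvec j) \<in> W \<and>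
          infdist (grid_pt (mindex \<nu> n) (rvec j)) (- W) < \<delta>}" for j
      proof
        define x where "x = grid_pt (mindex \<nu> n) (rvec j)"
        have x: "x \<in> W" "infdist x (- W) < \<delta>" using that by (auto simp: x_def)
        obtain u where "u \<in> - W" "infdist x (- W) = dist x u"
          using infdist_attains_inf[OF Compl_W] by metis
        then have "x \<in> ball x \<delta> \<inter> W" "u \<in> ball x \<delta> - W" using x \<delta> by auto
        \<comment> \<open>The ball is connected and meets both \<open>W\<close> and its complement,
          so it meets the frontier, which lies in that of \<open>\<Omega>\<close>.\<close>
        then have "ball x \<delta> \<inter> frontier W \<noteq> {}"
          by (intro connected_Int_frontier connected_ball) blast+
        then obtain v where v: "v \<in> frontier \<Omega>" "dist x v < \<delta>"
          using frontier_interior_subset by fastforce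
        fix z assume "z \<in> cball (grid_pt (mindex \<nu> n) (rvec j)) \<delta>"
        then have "dist z v \<le> 2 * \<delta>"
          using v(2) dist_triangle[of z v x] by (simp add: x_def[symmetric] dist_commute)
        then show "z \<in> {x. infdist x (frontier \<Omega>) \<le> 2 * \<delta>}"
          using infdist_le[OF v(1), of z] by simp
      qed
    qed auto
  qed
qed

end


section \<open>Norm-plus-rank splitting and the GLT symbol of the extended matrices\<close>

lemma measurable_lebesgue_on_continuous:
  fixes f :: "'a::euclidean_space \<Rightarrow> 'b::real_normed_vector"
  assumes "continuous_on UNIV f"
  shows "f \<in> borel_measurable (lebesgue_on S)"
  using measurable_restrict_space1[OF measurable_completion] borel_measurable_continuous_onI[OF assms]
  by (metis measurable_lborel2)

context shortley_weller
begin

definition symbol_term :: "'d \<Rightarrow> real^'d::{finite,linorder} \<Rightarrow> complex" where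
  "symbol_term k \<theta> = complex_of_real ((\<nu> $ k)\<^sup>2 * (2 - 2 * cos (\<theta> $ k)))"

lemma model_entry_eq:
  "complex_of_real (model_entry p n j i) =
    (\<Sum>k\<in>UNIV. complex_of_real (p k (\<chi> k. of_int (j $ k) / of_int (mindex \<nu> n $ k))) *
      fourier_coeff (symbol_term k) (j - i))"
  unfolding symbol_term_def fourier_coeff_laplace_symbol model_entry_def by simp

text \<open>The difference from the model is divided by rows: bad rows form \<open>R\<close>, whose
  rank is at most their number, and the remaining rows form \<open>N\<close>, where the entrywise
  estimate and Schur's test apply.\<close>

lemma eventually_acs_splitting:
  assumes \<delta>: "0 < \<delta>" and \<eta>: "0 < \<eta>" and ne: "frontier \<Omega> \<noteq> {}"
    and extends: "\<And>k. continuous_on UNIV (a' k)" "\<And>k. \<forall>x\<in>\<Omega>. a' k x = a k x"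
    and p: "\<And>k. \<forall>x\<in>cbox 0 1. \<bar>a' k x * min 1 (infdist x (- W) / \<delta>) - p k x\<bar> < \<eta>"
  shows "\<forall>\<^sub>F n in sequentially. n \<in> admissible \<nu> \<longrightarrow>
    (\<exists>N\<in>carrier_mat (msize (mindex \<nu> n)) (msize (mindex \<nu> n)).
     \<exists>R\<in>carrier_mat (msize (mindex \<nu> n)) (msize (mindex \<nu> n)).
       multilevel_mat (mindex \<nu> n) (\<lambda>j i. complex_of_real (extended_entry n j i)) =
         multilevel_mat (mindex \<nu> n) (\<lambda>j i. complex_of_real (model_entry p n j i)) + N + R \<and>
       spectral_norm N \<le> 3 * \<eta> * stencil_total (\<lambda>k. (\<nu> $ k)\<^sup>2) \<and>
       real (vec_space.rank (msize (mindex \<nu> n)) R)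
         \<le> 2 ^ CARD('d) * measure lebesgue {x. infdist x (frontier \<Omega>) \<le> 2 * \<delta>} * real (msize (mindex \<nu> n)))"
  using eventually_entry_close[OF \<delta> \<eta> extends p] eventually_card_bad_le[OF \<delta> ne]
proof eventually_elim
  case (elim n)
  show ?case
  proof
    assume n: "n \<in> admissible \<nu>"
    interpret multi_index "mindex \<nu> n" by (rule multi_index_mindex[OF n \<nu>_pos])
    define D where "D = (\<lambda>j i. extended_entry n j i - model_entry p n j i)"
    define bad where "bad = {j \<in> {1..mindex \<nu> n}. grid_pt (mindex \<nu> n) (rvec j) \<in> W \<and>
      infdist (grid_pt (mindex \<nu> n) (rvec j)) (- W) < \<delta>}"
    define N where "N = multilevel_mat (mindex \<nu> n) (\<lambda>j i. if j \<in> bad then 0 else complex_of_real (D j i))"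
    define R where "R = multilevel_mat (mindex \<nu> n) (\<lambda>j i. if j \<in> bad then complex_of_real (D j i) else 0)"
    have \<nu>2: "0 \<le> (\<nu> $ k)\<^sup>2" for k by simp
    have close: "cmod (if j \<in> bad then 0 else complex_of_real (D j i)) \<le> 3 * \<eta> * stencil_weight (\<lambda>k. (\<nu> $ k)\<^sup>2) j i"
      if "j \<in> {1..mindex \<nu> n}" "i \<in> {1..mindex \<nu> n}" for j i
    proof (cases "j \<in> bad")
      case True
      have "0 \<le> stencil_weight (\<lambda>k. (\<nu> $ k)\<^sup>2) j i"
        unfolding stencil_weight_def by (intro add_nonneg_nonneg sum_nonneg mult_nonneg_nonneg) auto
      then show ?thesis using True \<eta> by simp
    next
      case False
      then have "grid_pt (mindex \<nu> n) (rvec j) \<in> W \<longrightarrow> \<delta> \<le> infdist (grid_pt (mindex \<nu> n) (rvec j)) (- W)"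
        using that by (auto simp: bad_def not_less)
      then show ?thesis using elim(1) n that False by (simp add: D_def del: of_real_diff)
    qed
    have "spectral_norm N \<le> 3 * \<eta> * stencil_total (\<lambda>k. (\<nu> $ k)\<^sup>2)"
      unfolding N_def
    proof (rule spectral_norm_multilevel_mat_le)
      show "0 \<le> 3 * \<eta> * stencil_total (\<lambda>k. (\<nu> $ k)\<^sup>2)"
        using \<eta> stencil_total_nonneg[of "\<lambda>k. (\<nu> $ k)\<^sup>2"] by simp
      show "(\<Sum>i\<in>{1..mindex \<nu> n}. cmod (if j \<in> bad then 0 else complex_of_real (D j i)))
        \<le> 3 * \<eta> * stencil_total (\<lambda>k. (\<nu> $ k)\<^sup>2)" if "j \<in> {1..mindex \<nu> n}" for j
      proof -
        have "(\<Sum>i\<in>{1..mindex \<nu> n}. cmod (if j \<in> bad then 0 else complex_of_real (D j i)))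
          \<le> (\<Sum>i\<in>{1..mindex \<nu> n}. 3 * \<eta> * stencil_weight (\<lambda>k. (\<nu> $ k)\<^sup>2) j i)"
          by (intro sum_mono close that)
        also have "\<dots> = 3 * \<eta> * (\<Sum>i\<in>{1..mindex \<nu> n}. stencil_weight (\<lambda>k. (\<nu> $ k)\<^sup>2) j i)"
          by (simp only: sum_distrib_left)
        also have "\<dots> \<le> 3 * \<eta> * stencil_total (\<lambda>k. (\<nu> $ k)\<^sup>2)"
          using \<eta> by (intro mult_left_mono sum_stencil_weight_le finite_multi_index \<nu>2) simp
        finally show ?thesis .
      qed
      show "(\<Sum>j\<in>{1..mindex \<nu> n}. cmod (if j \<in> bad then 0 else complex_of_real (D j i)))
        \<le> 3 * \<eta> * stencil_total (\<lambda>k. (\<nu> $ k)\<^sup>2)" if "i \<in> {1..mindex \<nu> n}" for i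
      proof -
        have "(\<Sum>j\<in>{1..mindex \<nu> n}. cmod (if j \<in> bad then 0 else complex_of_real (D j i)))
          \<le> (\<Sum>j\<in>{1..mindex \<nu> n}. 3 * \<eta> * stencil_weight (\<lambda>k. (\<nu> $ k)\<^sup>2) j i)"
          by (intro sum_mono close that)
        also have "\<dots> = 3 * \<eta> * (\<Sum>j\<in>{1..mindex \<nu> n}. stencil_weight (\<lambda>k. (\<nu> $ k)\<^sup>2) j i)"
          by (simp only: sum_distrib_left)
        also have "\<dots> \<le> 3 * \<eta> * stencil_total (\<lambda>k. (\<nu> $ k)\<^sup>2)"
          using \<eta> by (intro mult_left_mono sum_stencil_weight_le finite_multi_index \<nu>2) simp
        finally show ?thesis .
      qed
    qed
    moreover have "vec_space.rank (msize (mindex \<nu> n)) R \<le> card bad"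
      unfolding R_def by (rule rank_multilevel_mat_le) (auto simp: bad_def)
    then have "real (vec_space.rank (msize (mindex \<nu> n)) R)
         \<le> 2 ^ CARD('d) * measure lebesgue {x. infdist x (frontier \<Omega>) \<le> 2 * \<delta>} * real (msize (mindex \<nu> n))"
      using elim(2) n unfolding bad_def[symmetric] by (meson of_nat_mono order_trans)
    moreover have "multilevel_mat (mindex \<nu> n) (\<lambda>j i. complex_of_real (extended_entry n j i)) =
         multilevel_mat (mindex \<nu> n) (\<lambda>j i. complex_of_real (model_entry p n j i)) + N + R"
      unfolding N_def R_def multilevel_mat_add
      by (intro arg_cong[where f = "multilevel_mat (mindex \<nu> n)"] ext) (simp add: D_def)
    ultimately show "\<exists>N\<in>carrier_mat (msize (mindex \<nu> n)) (msize (mindex \<nu> n)).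
     \<exists>R\<in>carrier_mat (msize (mindex \<nu> n)) (msize (mindex \<nu> n)).
       multilevel_mat (mindex \<nu> n) (\<lambda>j i. complex_of_real (extended_entry n j i)) =
         multilevel_mat (mindex \<nu> n) (\<lambda>j i. complex_of_real (model_entry p n j i)) + N + R \<and>
       spectral_norm N \<le> 3 * \<eta> * stencil_total (\<lambda>k. (\<nu> $ k)\<^sup>2) \<and>
       real (vec_space.rank (msize (mindex \<nu> n)) R)
         \<le> 2 ^ CARD('d) * measure lebesgue {x. infdist x (frontier \<Omega>) \<le> 2 * \<delta>} * real (msize (mindex \<nu> n))"
      unfolding N_def R_def using multilevel_mat_carrier by blast
  qed
qed

text \<open>One sequence \<open>r m\<close> tending to 0 serves as cut-off width, polynomial
  accuracy and boundary margin, so norm and rank bounds vanish together. The symbol is zero off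
  \<open>W\<close>.\<close>

lemma glt_extended:
  assumes ne: "\<Omega> \<noteq> {}" and null: "frontier \<Omega> \<in> null_sets lebesgue"
  obtains \<kappa> where
    "glt \<nu> (\<lambda>n. multilevel_mat (mindex \<nu> n) (\<lambda>j i. complex_of_real (extended_entry n j i))) \<kappa>"
    "\<And>x \<theta>. x \<in> W \<Longrightarrow> \<kappa> (x, \<theta>) = complex_of_real (\<Sum>k\<in>UNIV. (\<nu> $ k)\<^sup>2 * a k x * (2 - 2 * cos (\<theta> $ k)))"
proof -
  \<comment> \<open>A nonempty bounded set is not the whole space, so it has a frontier; otherwise
    distances to the frontier would carry no information.\<close>
  have fr: "frontier \<Omega> \<noteq> {}" "compact (frontier \<Omega>)"
    using ne compact not_bounded_UNIV compact_imp_bounded[OF compact]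
    by (auto simp: frontier_eq_empty compact_frontier)
  \<comment> \<open>Tietze extension makes the coefficient available on the whole cube, where the
    polynomial approximation takes place.\<close>
  have "\<exists>a'. continuous_on UNIV a' \<and> (\<forall>x\<in>\<Omega>. a' x = a k x)" for k
  proof -
    obtain M where M: "\<And>x. x \<in> \<Omega> \<Longrightarrow> norm (a k x) \<le> M"
      using compact_imp_bounded[OF compact_continuous_image[OF cont_a compact]]
      unfolding bounded_iff by blast
    have "0 \<le> M" using ne M norm_ge_zero order_trans by blast
    have cl: "closedin (top_of_set UNIV) \<Omega>" using closed by simp
    show ?thesis
    proof (rule Tietze[OF cont_a[of k] cl \<open>0 \<le> M\<close>])
      show "norm (a k x) \<le> M" if "x \<in> \<Omega>" for x using M[OF that] .
    qed blast
  qed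
  then obtain a' where a': "\<And>k. continuous_on UNIV (a' k)" "\<And>k. \<forall>x\<in>\<Omega>. a' k x = a k x"
    by metis
  define r where "r = (\<lambda>m. 1 / real (Suc m))"
  have r: "0 < r m" for m by (simp add: r_def)
  have r_lim: "r \<longlonglongrightarrow> 0" unfolding r_def by (rule LIMSEQ_Suc[OF lim_1_over_n])
  define g where "g = (\<lambda>m k x. a' k x * min 1 (infdist x (- W) / r m))"
  have g_cont: "continuous_on (cbox 0 1) (g m k)" for m k
    unfolding g_def using r[of m] by (intro continuous_intros continuous_on_subset[OF a'(1)]) auto
  have "\<exists>p. real_polynomial_function p \<and> (\<forall>x\<in>cbox 0 1. \<bar>g m k x - p x\<bar> < r m)" for m k
    using Stone_Weierstrass_real_polynomial_function[OF compact_cbox g_cont r] by metis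
  then obtain p where p: "\<And>m k. real_polynomial_function (p m k)"
      "\<And>m k x. x \<in> cbox 0 1 \<Longrightarrow> \<bar>g m k x - p m k x\<bar> < r m"
    by metis
  \<comment> \<open>The approximating sums in \<open>glt\<close> are numbered by naturals, so the
    coordinate directions are enumerated.\<close>
  obtain e where e: "bij_betw e {..<CARD('d)} (UNIV :: 'd set)"
    using ex_bij_betw_nat_finite[of "UNIV :: 'd set"] by (auto simp: lessThan_atLeast0)
  define \<kappa> :: "(real^'d::{finite,linorder}) \<times> (real^'d::{finite,linorder}) \<Rightarrow> complex" where
    "\<kappa> = (\<lambda>z. indicator (W \<times> UNIV) z * (\<Sum>k\<in>UNIV. complex_of_real (a' k (fst z)) * symbol_term k (snd z)))"
  have reindex: "(\<Sum>l<CARD('d). F (e l)) = (\<Sum>k\<in>UNIV. F k)" for F :: "'d \<Rightarrow> complex"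
    using sum.reindex_bij_betw[OF e] .
  have cont_p: "continuous_on UNIV (p m k)" for m k
    using continuous_real_polymonial_function[OF p(1)] by (intro continuous_at_imp_continuous_on) blast
  have cont_symbol: "continuous_on UNIV (symbol_term k)" for k
    unfolding symbol_term_def by (intro continuous_intros)
  show thesis
  proof (rule that)
    show "\<kappa> (x, \<theta>) = complex_of_real (\<Sum>k\<in>UNIV. (\<nu> $ k)\<^sup>2 * a k x * (2 - 2 * cos (\<theta> $ k)))" if "x \<in> W" for x \<theta>
      using that a'(2) subsetD[OF W_subset(1) that] by (simp add: \<kappa>_def symbol_term_def mult_ac)
    have "continuous_on UNIV (\<lambda>z::(real^'d::{finite,linorder}) \<times> (real^'d::{finite,linorder}).
        \<Sum>k\<in>UNIV. complex_of_real (a' k (fst z)) * symbol_term k (snd z))"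
      by (intro continuous_intros continuous_on_compose2[OF a'(1)] continuous_on_compose2[OF cont_symbol]) auto
    moreover have "open (W \<times> (UNIV :: (real^'d::{finite,linorder}) set))"
      by (intro open_Times) auto
    ultimately have \<kappa>_meas: "\<kappa> \<in> borel_measurable (lebesgue_on (unit_cube \<times> freq_cube))"
      unfolding \<kappa>_def
      by (intro borel_measurable_times measurable_lebesgue_on_continuous measurable_restrict_space1 borel_measurable_indicator)
        (auto intro: borel_open)
    show "glt \<nu> (\<lambda>n. multilevel_mat (mindex \<nu> n) (\<lambda>j i. complex_of_real (extended_entry n j i))) \<kappa>"
      unfolding glt_def
    proof (rule conjI[rotated], rule conjI[rotated], rule exI[of _ "\<lambda>_. CARD('d)"],
        rule exI[of _ "\<lambda>m l x. complex_of_real (p m (e l) x)"],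
        rule exI[of _ "\<lambda>m l. symbol_term (e l)"], intro conjI allI impI)
      show "\<forall>n\<in>admissible \<nu>. multilevel_mat (mindex \<nu> n) (\<lambda>j i. complex_of_real (extended_entry n j i))
        \<in> carrier_mat (msize (mindex \<nu> n)) (msize (mindex \<nu> n))"
        by (simp add: multilevel_mat_carrier)
      show "\<kappa> \<in> borel_measurable (lebesgue_on (unit_cube \<times> freq_cube))" by (rule \<kappa>_meas)
      show "Cinf_on unit_cube (\<lambda>x. complex_of_real (p m (e l) x))" for m l
        using p(1) by (rule Cinf_on_real_polynomial_function)
      show "trig_poly (symbol_term (e l))" for l
        unfolding symbol_term_def by (rule trig_poly_laplace_symbol)
      show "tendsto_in_measure (lebesgue_on (unit_cube \<times> freq_cube))
         (\<lambda>m (x, \<theta>). \<Sum>l<CARD('d). complex_of_real (p m (e l) x) * symbol_term (e l) \<theta>) \<kappa>"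
      proof (rule tendsto_in_measure_pointwise[OF _ _ \<kappa>_meas])
        let ?M = "lebesgue_on (unit_cube \<times> freq_cube) :: ((real^'d::{finite,linorder}) \<times> (real^'d::{finite,linorder})) measure"
        have "unit_cube \<times> freq_cube \<in> (lmeasurable :: ((real^'d::{finite,linorder}) \<times> (real^'d::{finite,linorder})) set set)"
          by (intro lmeasurable_compact compact_Times compact_cbox)
        then show "emeasure ?M (space ?M) < \<infinity>"
          by (subst emeasure_restrict_space) (auto simp: fmeasurable_def)
        show "(\<lambda>(x, \<theta>). \<Sum>l<CARD('d). complex_of_real (p m (e l) x) * symbol_term (e l) \<theta>)
          \<in> borel_measurable (lebesgue_on (unit_cube \<times> freq_cube))" for m
          unfolding case_prod_beta
          by (intro measurable_lebesgue_on_continuous continuous_intros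
              continuous_on_compose2[OF cont_p] continuous_on_compose2[OF cont_symbol]) auto
        fix z assume "z \<in> space ?M"
        then obtain x \<theta> where z: "z = (x, \<theta>)" and x: "x \<in> unit_cube" by (cases z) auto
        \<comment> \<open>For \<open>x\<close> in \<open>W\<close> the cut-off is 1 once
          \<open>r m\<close> falls below the positive distance to the complement; off
          \<open>W\<close> it is always 0. The polynomial error is below \<open>r m\<close>.\<close>
        have "(\<lambda>m. p m k x) \<longlonglongrightarrow> indicator W x * a' k x" for k
        proof -
          have "\<forall>\<^sub>F m in sequentially. g m k x = indicator W x * a' k x"
          proof (cases "x \<in> W")
            case True
            then have "0 < infdist x (- W)"
              using in_closed_iff_infdist_zero[OF Compl_W, of x] infdist_nonneg[of x "- W"] by auto
            from order_tendstoD(2)[OF r_lim this] show ?thesis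
            proof eventually_elim
              case (elim m)
              then have "1 \<le> infdist x (- W) / r m" using r[of m] by simp
              then show ?case using True by (simp add: g_def min_def)
            qed
          qed (simp add: g_def)
          then have "(\<lambda>m. g m k x) \<longlonglongrightarrow> indicator W x * a' k x" by (rule tendsto_eventually)
          moreover have "(\<lambda>m. g m k x - p m k x) \<longlonglongrightarrow> 0"
            using p(2)[OF x, of _ k] by (intro Lim_null_comparison[OF _ r_lim]) (auto simp: less_imp_le)
          ultimately have "(\<lambda>m. g m k x - (g m k x - p m k x)) \<longlonglongrightarrow> indicator W x * a' k x - 0"
            by (rule tendsto_diff)
          then show ?thesis by simp
        qed
        then have "(\<lambda>m. \<Sum>k\<in>UNIV. complex_of_real (p m k x) * symbol_term k \<theta>) \<longlonglongrightarrow>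
            (\<Sum>k\<in>UNIV. complex_of_real (indicator W x * a' k x) * symbol_term k \<theta>)"
          by (intro tendsto_intros)
        also have "(\<Sum>k\<in>UNIV. complex_of_real (indicator W x * a' k x) * symbol_term k \<theta>) = \<kappa> z"
          by (simp add: \<kappa>_def z sum_distrib_left indicator_def)
        finally show "(\<lambda>m. (\<lambda>(x, \<theta>). \<Sum>l<CARD('d). complex_of_real (p m (e l) x) * symbol_term (e l) \<theta>) z) \<longlonglongrightarrow> \<kappa> z"
          using reindex[of "\<lambda>k. complex_of_real (p _ k x) * symbol_term k \<theta>"] by (simp add: z)
      qed
      define \<rho> where "\<rho> = (\<lambda>m. 2 ^ CARD('d) * measure lebesgue {x. infdist x (frontier \<Omega>) \<le> 2 * r m})"
      define \<omega> where "\<omega> = (\<lambda>m. 3 * r m * stencil_total (\<lambda>k. (\<nu> $ k)\<^sup>2))"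
      show "acs_converges (admissible \<nu>) (\<lambda>n. msize (mindex \<nu> n))
         (\<lambda>n m. mat_sum (msize (mindex \<nu> n))
            (\<lambda>l. diag_sampling_mat (\<lambda>x. complex_of_real (p m (e l) x)) (mindex \<nu> n) *
               toeplitz_mat (symbol_term (e l)) (mindex \<nu> n)) CARD('d))
         (\<lambda>n. multilevel_mat (mindex \<nu> n) (\<lambda>j i. complex_of_real (extended_entry n j i)))"
        unfolding acs_converges_def
      proof (rule exI[of _ \<omega>], rule exI[of _ \<rho>], intro conjI allI)
        show "\<omega> \<longlonglongrightarrow> 0"
          unfolding \<omega>_def using tendsto_mult_left_zero[OF tendsto_mult_right_zero[OF r_lim]] .
        have "(\<lambda>m. measure lebesgue {x. infdist x (frontier \<Omega>) \<le> 2 * r m}) \<longlonglongrightarrow> 0"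
        proof (rule measure_infdist_tendsto_0[OF fr(2,1) null])
          show "decseq (\<lambda>m. 2 * r m)" by (auto simp: decseq_def r_def frac_le)
          show "0 < 2 * r m" for m using r by simp
          show "(\<lambda>m. 2 * r m) \<longlonglongrightarrow> 0" by (rule tendsto_mult_right_zero[OF r_lim])
        qed
        then show "\<rho> \<longlonglongrightarrow> 0" unfolding \<rho>_def by (rule tendsto_mult_right_zero)
        fix m
        have B: "mat_sum (msize (mindex \<nu> n))
            (\<lambda>l. diag_sampling_mat (\<lambda>x. complex_of_real (p m (e l) x)) (mindex \<nu> n) *
               toeplitz_mat (symbol_term (e l)) (mindex \<nu> n)) CARD('d) =
            multilevel_mat (mindex \<nu> n) (\<lambda>j i. complex_of_real (model_entry (p m) n j i))" if "n \<in> admissible \<nu>" for n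
          unfolding multi_index.mat_sum_diag_times_toeplitz[OF multi_index_mindex[OF that \<nu>_pos]] model_entry_eq
          using reindex[of "\<lambda>k. complex_of_real (p m k (\<chi> l. of_int (j $ l) / of_int (mindex \<nu> n $ l))) *
            fourier_coeff (symbol_term k) (j - i)" for j i] by simp
        \<comment> \<open>The splitting is used with both \<open>\<delta>\<close> and
          \<open>\<eta>\<close> equal to \<open>r m\<close>.\<close>
        have "\<forall>x\<in>cbox 0 1. \<bar>a' k x * min 1 (infdist x (- W) / r m) - p m k x\<bar> < r m" for k
          using p(2)[of _ m k] by (simp add: g_def)
        from eventually_acs_splitting[OF r r fr(1) a' this]
        obtain n0 where "\<forall>n\<ge>n0. n \<in> admissible \<nu> \<longrightarrow>
          (\<exists>N\<in>carrier_mat (msize (mindex \<nu> n)) (msize (mindex \<nu> n)).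
           \<exists>R\<in>carrier_mat (msize (mindex \<nu> n)) (msize (mindex \<nu> n)).
             multilevel_mat (mindex \<nu> n) (\<lambda>j i. complex_of_real (extended_entry n j i)) =
               multilevel_mat (mindex \<nu> n) (\<lambda>j i. complex_of_real (model_entry (p m) n j i)) + N + R \<and>
             spectral_norm N \<le> \<omega> m \<and>
             real (vec_space.rank (msize (mindex \<nu> n)) R) \<le> \<rho> m * real (msize (mindex \<nu> n)))"
          unfolding eventually_sequentially \<omega>_def \<rho>_def by blast
        then show "\<exists>n0. \<forall>n\<in>admissible \<nu>. n > n0 \<longrightarrow>
          (\<exists>N\<in>carrier_mat (msize (mindex \<nu> n)) (msize (mindex \<nu> n)).
           \<exists>R\<in>carrier_mat (msize (mindex \<nu> n)) (msize (mindex \<nu> n)).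
             multilevel_mat (mindex \<nu> n) (\<lambda>j i. complex_of_real (extended_entry n j i)) =
               mat_sum (msize (mindex \<nu> n))
                (\<lambda>l. diag_sampling_mat (\<lambda>x. complex_of_real (p m (e l) x)) (mindex \<nu> n) *
                   toeplitz_mat (symbol_term (e l)) (mindex \<nu> n)) CARD('d) + N + R \<and>
             spectral_norm N \<le> \<omega> m \<and>
             real (vec_space.rank (msize (mindex \<nu> n)) R) \<le> \<rho> m * real (msize (mindex \<nu> n)))"
          using B by (intro exI[of _ n0]) (simp add: less_imp_le)
      qed
    qed
  qed
qed

end

section \<open>Restriction of the extended sequence to the interior\<close>

theorem theorem5p1:
  fixes \<Omega> :: "(real^'d::{finite,linorder}) set"
    and a b :: "'d \<Rightarrow> real^'d::{finite,linorder} \<Rightarrow> real"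
    and c :: "real^'d::{finite,linorder} \<Rightarrow> real"
    and \<nu> :: "real^'d::{finite,linorder}"
  assumes "closed \<Omega>" and "\<Omega> \<subseteq> unit_cube" and "peano_jordan \<Omega>" and "emeasure lebesgue \<Omega> > 0"
    and "\<And>k. Ck_on 1 \<Omega> (a k)"
    and "\<And>k. continuous_on \<Omega> (b k)"
    and "continuous_on \<Omega> c"
    and "\<And>k. \<nu> $ k \<in> \<rat> \<and> \<nu> $ k > 0"
  shows "reduced_glt \<nu> (interior \<Omega>)
    (\<lambda>n. complex_of_real (1 / (real n)\<^sup>2) \<cdot>\<^sub>m sw_matrix a b c (interior \<Omega>) (mindex \<nu> n))
    (\<lambda>(x, \<theta>). complex_of_real (\<Sum>k\<in>UNIV. (\<nu> $ k)\<^sup>2 * a k x * (2 - 2 * cos (\<theta> $ k))))"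
proof -
  have "continuous_on \<Omega> (a k)" for k using assms(5)[of k] by simp
  then interpret shortley_weller \<Omega> a b c \<nu>
    using assms by unfold_locales auto
  have null: "frontier \<Omega> \<in> null_sets lebesgue" using assms(3) by (simp add: peano_jordan_def)
  have ne: "\<Omega> \<noteq> {}" using assms(4) by auto
  obtain \<kappa> where \<kappa>: "glt \<nu> (\<lambda>n. multilevel_mat (mindex \<nu> n) (\<lambda>j i. complex_of_real (extended_entry n j i))) \<kappa>"
    "\<And>x \<theta>. x \<in> W \<Longrightarrow> \<kappa> (x, \<theta>) = complex_of_real (\<Sum>k\<in>UNIV. (\<nu> $ k)\<^sup>2 * a k x * (2 - 2 * cos (\<theta> $ k)))"
    using glt_extended[OF ne null] by blast
  show ?thesis
    unfolding reduced_glt_def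
  proof (intro conjI)
    show "W \<subseteq> unit_cube" using W_subset(1) assms(2) by blast
    show "peano_jordan W"
      unfolding peano_jordan_def
      using null_sets_completion_subset[OF frontier_interior_subset null] .
    \<comment> \<open>A closed set is its interior together with its frontier; as the frontier is
      null, the interior inherits the positive measure.\<close>
    have "emeasure lebesgue \<Omega> = emeasure lebesgue (W \<union> frontier \<Omega>)"
      using closed by (simp add: frontier_def closure_closed Un_absorb1 interior_subset)
    also have "\<dots> = emeasure lebesgue W"
      by (rule emeasure_Un_null_set[OF _ null]) simp
    finally show "0 < emeasure lebesgue W" using assms(4) by simp
    show "\<exists>A \<kappa>. glt \<nu> A \<kappa> \<and>
        (\<forall>n\<in>admissible \<nu>. complex_of_real (1 / (real n)\<^sup>2) \<cdot>\<^sub>m sw_matrix a b c W (mindex \<nu> n) = restr_mat W (mindex \<nu> n) (A n)) \<and>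
        (AE z in lebesgue_on (W \<times> freq_cube).
          (case z of (x, \<theta>) \<Rightarrow> complex_of_real (\<Sum>k\<in>UNIV. (\<nu> $ k)\<^sup>2 * a k x * (2 - 2 * cos (\<theta> $ k)))) = \<kappa> z)"
    proof (intro exI conjI ballI)
      show "glt \<nu> (\<lambda>n. multilevel_mat (mindex \<nu> n) (\<lambda>j i. complex_of_real (extended_entry n j i))) \<kappa>"
        by (rule \<kappa>(1))
      show "AE z in lebesgue_on (W \<times> freq_cube).
          (case z of (x, \<theta>) \<Rightarrow> complex_of_real (\<Sum>k\<in>UNIV. (\<nu> $ k)\<^sup>2 * a k x * (2 - 2 * cos (\<theta> $ k)))) = \<kappa> z"
        using \<kappa>(2) by (intro AE_I2) auto
    qed (rule scaled_sw_matrix_eq_restr_mat)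
  qed
qed

end
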